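(* Consider the seven types of catenoids defined in the context, with the normalization given there (rotation axis equal to the $x_3$-axis, neck at height $x_3=0$, neck radius $1$). Two profile curves are called the same if they have the same vertex set (discrete profile curves) or are the same subset of the $x_1x_3$-plane (smooth profile curves). Then: 1. No $PR^{va}_{pd,rd}$-catenoid profile curve (any $\ell>0$, any integer $K\ge 3$) is the same as an $M^{va}_{pd,rs}$-catenoid profile curve (any $\Lambda>0$). However, for each fixed $\ell>0$, the $PR^{va}_{pd,rd}$-catenoid profile curves with vertical step $\ell$ converge (vertex by vertex) to the $M^{va}_{pd,rs}$-catenoid profile curve with $\Lambda=\ell$ as the angle of rotation symmetry $2\pi/K$ approaches $0$. 2. $BP^{in}_{pd,rd}$-catenoids and $MW^{in}_{pd,rs}$-catenoids have the same profile curves: for each vertical step $\ell>0$, the $BP^{in}_{pd,rd}$-catenoids with $\sinh c_1=\ell$ (for any admissible $c_2$) and the $MW^{in}_{pd,rs}$-catenoid with $h=\ell$ have the same profile curve. 3. No $BP^{in}_{pd,rd}$-catenoid profile curve (equivalently, no $MW^{in}_{pd,rs}$-catenoid profile curve) is the same as a $PR^{va}_{pd,rd}$-catenoid profile curve, and no $BP^{in}_{pd,rd}$-catenoid profile curve (equivalently, no $MW^{in}_{pd,rs}$-catenoid profile curve) is the same as an $M^{va}_{pd,rs}$-catenoid profile curve. 4. The smooth catenoid and every $MW^{in}_{ps,rd}$-catenoid have the same profile curve. 5. No $M^{va}_{ps,rd}$-catenoid profile curve (any integer $K\ge 3$) is the same as the smooth catenoid's profile curve. The $M^{va}_{ps,rd}$-catenoid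 profile curves converge (uniformly on compact $t$-intervals) to the smooth catenoid's profile curve (which is also the $MW^{in}_{ps,rd}$-catenoid profile curve) as the angle of rotation symmetry $2\pi/K$ approaches $0$. 6. For every catenoid of each of the seven types, the profile curve (its vertices, if the profile curve is discrete) lies on an affinely scaled graph of the hyperbolic cosine function, i.e. on a curve $\{x_1=a\cosh(b\,x_3),\ x_2=0\}$ for some constants $a,b>0$.
   Context: **Semi-discrete surfaces.** A semi-discrete surface is a map $x=x(k,t)$, smooth in $t$, from a domain in $\mathbb{Z}\times\mathbb{R}$ to $\mathbb{R}^3$. Write $x_1=x(k+1,t)$ (similarly for other functions of $(k,t)$), $\partial x=\partial x/\partial t$, $\Delta x=x_1-x$, $\partial\Delta x=\partial x_1-\partial x$. - $x$ is conjugate if $\partial x,\Delta x,\partial\Delta x$ are linearly dependent at every $(k,t)$. - $x$ is circular if for all $(k,t)$ there is a circle (a straight line being allowed as a degenerate circle) through $x$ and $x_1$, tangent there to $\partial x$ and $\partial x_1$ respectively, such that $\partial x$ and $\partial x_1$ induce opposite orientations of this circle. (For $x$ in a plane $\mathbb{R}^2\cong\mathbb{C}$ and a genuine circle this is equivalent to $\Delta x=\mathrm{i}s\left(\frac{\partial x}{\|\partial x\|}+\frac{\partial x_1}{\|\partial x_1\|}\right)$ for some real $s=s(k,t)\neq0$.) - A circular $x$ is isothermic if there are positive functions $\nu,\sigma,\tau$ with $\|\Delta x\|^2=\sigma\nu\nu_1$, $\|\partial x\|^2=\tau\nu^2$, $\partial\sigma=0$, $\Delta\tau=0$ (so $\sigma=\sigma(k)$,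 $\tau=\tau(t)$). - Conjugate surfaces $x,x^*$ are dual (with respect to $\nu$) if $\partial x^*=-\frac{1}{\nu^2}\partial x$ and $\Delta x^*=\frac{1}{\nu\nu_1}\Delta x$; for isothermic $x$ the function $\nu$ is the one in the definition of isothermic. - An isothermic $x$ is minimal if its dual $x^*$ is inscribed in a sphere (all its points lie on one sphere). **Naming.** Superscript $va$ / $in$: variational / integrable systems construction. Subscript $pd$/$ps$: discrete/smooth profile curve; $rd$/$rs$: discrete/smooth in the rotational direction. Catenoids with discrete profile curve are assumed to have neck-vertex symmetry: a plane of reflective symmetry perpendicular to the axis contains one vertex of each profile curve. All catenoids have the $x_3$-axis as rotation axis, profile curve in the $x_1x_3$-plane, and are normalized by homothety and vertical translation so that the neck is at height $0$ with radius $1$. **The seven types.** - *Smooth catenoid:* $(\cosh u\cos v,\cosh u\sin v,u)^t$; profile curve $(\cosh t,0,t)^t$, $t\in\mathbb{R}$. - *$PR^{va}_{pd,rd}$-catenoid* (Polthier–Rossman), parameters $\ell>0$ and an integer $K\ge3$, angle of rotation symmetry $\theta=2\pi/K$: the profile curve has vertices $\left(\cosh\!\left(n\,\mathrm{arccosh}\!\left(1+\frac{\ell^2}{1+\cos\theta}\right)\right),0,n\ell\right)^t$, $n\in\mathbb{Z}$. - *$M^{va}_{pd,rs}$-catenoid* (Machigashira), parameter $\Lambda>0$: the profile curve has vertices $\left(T_{|n|}(1+\tfrac12\Lambda^2),0,n\Lambda\right)^t$, $n\in\mathbb{Z}$, where $T_n$ are the Chebyshev polynomials of the first kind: $T_0(z)=1$,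 $T_1(z)=z$, $T_n(z)=2zT_{n-1}(z)-T_{n-2}(z)$ for $n\ge2$. - *$BP^{in}_{pd,rd}$-catenoid* (Bobenko–Pinkall), parameters $c_1>0$ and $c_2\in\mathbb{R}\setminus2\pi\mathbb{Z}$: the map $x:\mathbb{Z}^2\to\mathbb{R}^3$ with $x(0,0)=(1,0,0)^t$ and, for $p=(n,m)$ and $q\in\{(n+1,m),(n,m+1)\}$, $$x(q)-x(p)=\mathrm{Re}\left(\frac{a_{pq}}{g_q-g_p}\begin{pmatrix}1-g_qg_p\\ \mathrm{i}+\mathrm{i}g_qg_p\\ g_q+g_p\end{pmatrix}\right),$$ where $g_{n,m}=-e^{c_1n+\mathrm{i}c_2m}$, $a_{pq}=2\sinh^2\frac{c_1}{2}$ if $q=(n+1,m)$, and $a_{pq}=-2\sin^2\frac{c_2}{2}$ if $q=(n,m+1)$. Its profile curve is the sequence of vertices $x(n,0)$, $n\in\mathbb{Z}$. - *$MW^{in}_{pd,rs}$-catenoid* (Mueller–Wallner), parameter $h>0$: a semi-discrete minimal surface of the form $x(k,t)=(f(k)\cos t,f(k)\sin t,hk)^t$, $k\in\mathbb{Z}$, $t\in\mathbb{R}$, with $f>0$, $f(0)=1$, $f(-k)=f(k)$. Its profile curve has vertices $(f(k),0,hk)^t$, $k\in\mathbb{Z}$. - *$MW^{in}_{ps,rd}$-catenoid* (Mueller–Wallner), parameter $\alpha>0$, $\alpha\notin2\pi\mathbb{Z}$: a semi-discrete minimal surface of the form $x(k,t)=(f(t)\cos\alpha k,f(t)\sin\alpha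 k,t)^t$, $k\in\mathbb{Z}$, $t\in\mathbb{R}$, with $f>0$ smooth, $f(0)=1$, $f'(0)=0$. Its profile curve is $(f(t),0,t)^t$, $t\in\mathbb{R}$. - *$M^{va}_{ps,rd}$-catenoid*, parameter an integer $K\ge3$, angle of rotation symmetry $2\pi/K$: the surface made of $K$ congruent pieces (rotated by multiples of $2\pi/K$ about the $x_3$-axis), each foliated by the horizontal line segments joining $(x(t),0,t)^t$ to $(x(t)\cos\frac{2\pi}{K},x(t)\sin\frac{2\pi}{K},t)^t$, where $x:\mathbb{R}\to(0,\infty)$ is smooth, $x(0)=1$, $x'(0)=0$, and on every compact interval $I$ the function $x|_I$ is critical, for smooth variations fixing the values at the endpoints of $I$, for the area of a piece $$A=\int_I x\sqrt{2\left(1-\cos\tfrac{2\pi}{K}\right)+\left(\sin\tfrac{2\pi}{K}\right)^2(x')^2}\,dt .$$ Its profile curve is $(x(t),0,t)^t$, $t\in\mathbb{R}$. *)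

theory Defs
  imports "HOL-Analysis.Analysis"
begin

definition smooth :: "(real \<Rightarrow> 'a::real_normed_vector) \<Rightarrow> bool" where
  "smooth f \<longleftrightarrow>
     (\<exists>D. D 0 = f \<and> (\<forall>n t. (D n has_vector_derivative D (Suc n) t) (at t)))"

type_synonym semi_discrete = "int \<Rightarrow> real \<Rightarrow> real^3"

definition semi_discrete_surface :: "semi_discrete \<Rightarrow> bool" where
  "semi_discrete_surface x \<longleftrightarrow> (\<forall>k. smooth (x k))"

definition del :: "semi_discrete \<Rightarrow> semi_discrete" where
  "del x k t = vector_derivative (x k) (at t)"

definition Delta :: "semi_discrete \<Rightarrow> semi_discrete" where
  "Delta x k t = x (k + 1) t - x k t"

text \<open>Linear dependence is meant for the triple, so coinciding vectors count as dependent;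
  hence it is not expressed by \<^const>\<open>dependent\<close> applied to a set.\<close>

definition conjugate :: "semi_discrete \<Rightarrow> bool" where
  "conjugate x \<longleftrightarrow> semi_discrete_surface x \<and>
     (\<forall>k t. \<exists>a b c. (a, b, c) \<noteq> (0, 0, 0) \<and>
        a *\<^sub>R del x k t + b *\<^sub>R Delta x k t + c *\<^sub>R Delta (del x) k t = 0)"

text \<open>The point with angle \<open>\<phi>\<close> on the circle with centre \<open>c\<close> and radius \<open>r\<close> in the plane
  spanned by the orthonormal vectors \<open>e1\<close>, \<open>e2\<close>, and its positively oriented unit tangent
  vector.\<close>

definition circle_point :: "real^3 \<Rightarrow> real \<Rightarrow> real^3 \<Rightarrow> real^3 \<Rightarrow> real \<Rightarrow> real^3" where
  "circle_point c r e1 e2 \<phi> = c + r *\<^sub>R (cos \<phi> *\<^sub>R e1 + sin \<phi> *\<^sub>R e2)"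

definition circle_tangent :: "real^3 \<Rightarrow> real^3 \<Rightarrow> real \<Rightarrow> real^3" where
  "circle_tangent e1 e2 \<phi> = - sin \<phi> *\<^sub>R e1 + cos \<phi> *\<^sub>R e2"

text \<open>There is a circle through \<open>p\<close> and \<open>q\<close>, tangent there to \<open>v\<close> and \<open>w\<close> respectively, on
  which \<open>v\<close> and \<open>w\<close> induce opposite orientations. Replacing \<open>e2\<close> by \<open>- e2\<close> reverses the
  orientation of the circle, so letting \<open>v\<close> be positively oriented is no restriction.\<close>

definition oppositely_tangent_circle ::
    "real^3 \<Rightarrow> real^3 \<Rightarrow> real^3 \<Rightarrow> real^3 \<Rightarrow> bool" where
  "oppositely_tangent_circle p v q w \<longleftrightarrow>
     (\<exists>c r e1 e2 \<phi> \<psi> a b.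
        r > 0 \<and> norm e1 = 1 \<and> norm e2 = 1 \<and> e1 \<bullet> e2 = 0 \<and> a > 0 \<and> b > 0 \<and>
        p = circle_point c r e1 e2 \<phi> \<and> v = a *\<^sub>R circle_tangent e1 e2 \<phi> \<and>
        q = circle_point c r e1 e2 \<psi> \<and> w = - (b *\<^sub>R circle_tangent e1 e2 \<psi>))"

definition oppositely_tangent_line ::
    "real^3 \<Rightarrow> real^3 \<Rightarrow> real^3 \<Rightarrow> real^3 \<Rightarrow> bool" where
  "oppositely_tangent_line p v q w \<longleftrightarrow>
     (\<exists>u s a b. u \<noteq> 0 \<and> a > 0 \<and> b > 0 \<and>
        q = p + s *\<^sub>R u \<and> v = a *\<^sub>R u \<and> w = - (b *\<^sub>R u))"

definition circular :: "semi_discrete \<Rightarrow> bool" where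
  "circular x \<longleftrightarrow> semi_discrete_surface x \<and>
     (\<forall>k t. oppositely_tangent_circle (x k t) (del x k t) (x (k + 1) t) (del x (k + 1) t) \<or>
            oppositely_tangent_line (x k t) (del x k t) (x (k + 1) t) (del x (k + 1) t))"

definition isothermic_wrt :: "semi_discrete \<Rightarrow> (int \<Rightarrow> real \<Rightarrow> real) \<Rightarrow> bool" where
  "isothermic_wrt x \<nu> \<longleftrightarrow> circular x \<and> (\<forall>k t. \<nu> k t > 0) \<and>
     (\<exists>(\<sigma> :: int \<Rightarrow> real) (\<tau> :: real \<Rightarrow> real). (\<forall>k. \<sigma> k > 0) \<and> (\<forall>t. \<tau> t > 0) \<and>
        (\<forall>k t. (norm (Delta x k t))\<^sup>2 = \<sigma> k * \<nu> k t * \<nu> (k + 1) t \<and>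
               (norm (del x k t))\<^sup>2 = \<tau> t * (\<nu> k t)\<^sup>2))"

definition dual_wrt :: "(int \<Rightarrow> real \<Rightarrow> real) \<Rightarrow> semi_discrete \<Rightarrow> semi_discrete \<Rightarrow> bool" where
  "dual_wrt \<nu> x y \<longleftrightarrow> conjugate x \<and> conjugate y \<and>
     (\<forall>k t. del y k t = - ((1 / (\<nu> k t)\<^sup>2) *\<^sub>R del x k t) \<and>
            Delta y k t = (1 / (\<nu> k t * \<nu> (k + 1) t)) *\<^sub>R Delta x k t)"

definition minimal :: "semi_discrete \<Rightarrow> bool" where
  "minimal x \<longleftrightarrow>
     (\<exists>\<nu> y c r. isothermic_wrt x \<nu> \<and> dual_wrt \<nu> x y \<and> r > 0 \<and> (\<forall>k t. y k t \<in> sphere c r))"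

definition graph_profile :: "(real \<Rightarrow> real) \<Rightarrow> (real^3) set" where
  "graph_profile f = range (\<lambda>t. vector [f t, 0, t])"

abbreviation smooth_catenoid_profile :: "(real^3) set" where
  "smooth_catenoid_profile \<equiv> graph_profile cosh"

definition PR_vertex :: "real \<Rightarrow> nat \<Rightarrow> int \<Rightarrow> real^3" where
  "PR_vertex l K n =
     vector [cosh (of_int n * arcosh (1 + l\<^sup>2 / (1 + cos (2 * pi / real K)))), 0, of_int n * l]"

fun chebyshev_T :: "nat \<Rightarrow> real \<Rightarrow> real" where
  "chebyshev_T 0 z = 1"
| "chebyshev_T (Suc 0) z = z"
| "chebyshev_T (Suc (Suc n)) z = 2 * z * chebyshev_T (Suc n) z - chebyshev_T n z"

definition M_pd_rs_vertex :: "real \<Rightarrow> int \<Rightarrow> real^3" where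
  "M_pd_rs_vertex L n = vector [chebyshev_T (nat \<bar>n\<bar>) (1 + L\<^sup>2 / 2), 0, of_int n * L]"

definition BP_g :: "real \<Rightarrow> real \<Rightarrow> int \<times> int \<Rightarrow> complex" where
  "BP_g c1 c2 = (\<lambda>(n, m). - exp (complex_of_real (c1 * of_int n) + \<i> * complex_of_real (c2 * of_int m)))"

definition BP_edge :: "real \<Rightarrow> complex \<Rightarrow> complex \<Rightarrow> real^3" where
  "BP_edge a gp gq =
     (let w = complex_of_real a / (gq - gp)
      in vector [Re (w * (1 - gq * gp)), Re (w * (\<i> + \<i> * gq * gp)), Re (w * (gq + gp))])"

definition BP_catenoid :: "real \<Rightarrow> real \<Rightarrow> (int \<times> int \<Rightarrow> real^3) \<Rightarrow> bool" where
  "BP_catenoid c1 c2 x \<longleftrightarrow>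
     c1 > 0 \<and> (\<forall>j::int. c2 \<noteq> 2 * pi * of_int j) \<and>
     x (0, 0) = vector [1, 0, 0] \<and>
     (\<forall>n m. x (n + 1, m) - x (n, m) =
              BP_edge (2 * (sinh (c1 / 2))\<^sup>2) (BP_g c1 c2 (n, m)) (BP_g c1 c2 (n + 1, m)) \<and>
            x (n, m + 1) - x (n, m) =
              BP_edge (- 2 * (sin (c2 / 2))\<^sup>2) (BP_g c1 c2 (n, m)) (BP_g c1 c2 (n, m + 1)))"

definition BP_profile :: "(int \<times> int \<Rightarrow> real^3) \<Rightarrow> (real^3) set" where
  "BP_profile x = range (\<lambda>n. x (n, 0))"

text \<open>The catenoids below are identified with the functions generating their profile curves; such
  a function determines the surface.\<close>

definition MW_pd_rs_catenoid :: "real \<Rightarrow> (int \<Rightarrow> real) \<Rightarrow> bool" where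
  "MW_pd_rs_catenoid h f \<longleftrightarrow>
     h > 0 \<and> (\<forall>k. f k > 0) \<and> f 0 = 1 \<and> (\<forall>k. f (- k) = f k) \<and>
     minimal (\<lambda>k t. vector [f k * cos t, f k * sin t, h * of_int k])"

definition MW_pd_rs_profile :: "real \<Rightarrow> (int \<Rightarrow> real) \<Rightarrow> (real^3) set" where
  "MW_pd_rs_profile h f = range (\<lambda>k. vector [f k, 0, h * of_int k])"

definition MW_ps_rd_catenoid :: "real \<Rightarrow> (real \<Rightarrow> real) \<Rightarrow> bool" where
  "MW_ps_rd_catenoid \<alpha> f \<longleftrightarrow>
     \<alpha> > 0 \<and> (\<forall>j::int. \<alpha> \<noteq> 2 * pi * of_int j) \<and>
     smooth f \<and> (\<forall>t. f t > 0) \<and> f 0 = 1 \<and> deriv f 0 = 0 \<and>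
     minimal (\<lambda>k t. vector [f t * cos (\<alpha> * of_int k), f t * sin (\<alpha> * of_int k), t])"

definition M_ps_rd_area :: "nat \<Rightarrow> real \<Rightarrow> real \<Rightarrow> (real \<Rightarrow> real) \<Rightarrow> real" where
  "M_ps_rd_area K a b x =
     integral {a..b} (\<lambda>t. x t * sqrt (2 * (1 - cos (2 * pi / real K))
                                        + (sin (2 * pi / real K))\<^sup>2 * (deriv x t)\<^sup>2))"

text \<open>Variations of the form \<open>x + \<epsilon> \<eta>\<close> suffice, since the first variation depends only on the
  variation field \<open>\<eta>\<close>; fixing the values at the endpoints means that \<open>\<eta>\<close> vanishes there.\<close>

definition M_ps_rd_critical :: "nat \<Rightarrow> real \<Rightarrow> real \<Rightarrow> (real \<Rightarrow> real) \<Rightarrow> bool" where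
  "M_ps_rd_critical K a b x \<longleftrightarrow>
     (\<forall>\<eta>. smooth \<eta> \<and> \<eta> a = 0 \<and> \<eta> b = 0 \<longrightarrow>
        ((\<lambda>\<epsilon>. M_ps_rd_area K a b (\<lambda>t. x t + \<epsilon> * \<eta> t)) has_real_derivative 0) (at 0))"

definition M_ps_rd_catenoid :: "nat \<Rightarrow> (real \<Rightarrow> real) \<Rightarrow> bool" where
  "M_ps_rd_catenoid K x \<longleftrightarrow>
     K \<ge> 3 \<and> smooth x \<and> (\<forall>t. x t > 0) \<and> x 0 = 1 \<and> deriv x 0 = 0 \<and>
     (\<forall>a b. a < b \<longrightarrow> M_ps_rd_critical K a b x)"

definition on_scaled_cosh :: "(real^3) set \<Rightarrow> bool" where
  "on_scaled_cosh P \<longleftrightarrow>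
     (\<exists>a b. a > 0 \<and> b > 0 \<and> P \<subseteq> {p. p $ 1 = a * cosh (b * p $ 3) \<and> p $ 2 = 0})"

end

theory Submission
  imports Defs "HOL-Computational_Algebra.Polynomial"
begin

text \<open>Every profile curve in the theorem turns out to be explicit. The discrete ones are all of the form
\<open>(cosh (n a), 0, n l)\<close> with a vertical step \<open>l\<close> and a hyperbolic step \<open>a\<close>, and the smooth ones are
\<open>(cosh (\<beta> t), 0, t)\<close>. Two discrete curves of this form agree only if both steps agree, so all the
comparisons reduce to comparing hyperbolic steps for one and the same \<open>l\<close>:
\<open>arsinh l < arcosh (1 + l\<^sup>2 / 2) < arcosh (1 + l\<^sup>2 / (1 + cos \<theta>))\<close>. The first is the step of the two
integrable-systems types, the second that of Machigashira's catenoids, the third that of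
Polthier and Rossman; the third tends to the second as \<open>\<theta>\<close> tends to \<open>0\<close>. In the smooth case
\<open>\<beta> = 1\<close> for the smooth and for the integrable-systems catenoids, whereas
\<open>\<beta> = sqrt (2 / (1 + cos \<theta>)) > 1\<close>, again tending to \<open>1\<close>, for the variational ones.

The work lies in finding these explicit forms from the definitions.

For the semi-discrete minimal surfaces, the isothermic condition fixes the function \<open>\<nu>\<close> up to a
constant factor, namely as a multiple of the radius \<open>f\<close>; hence the dual surface is known up to
scaling and translation. That it lies on a sphere is then one scalar equation. With a
discrete profile curve it says that, up to a common factor, \<open>1 / f\<close> and the height \<open>Z\<close> of the dual
are the coordinates of a point on a circle, while duality makes \<open>Z\<close> grow by \<open>h / (f f\<^sub>1)\<close>; writing
\<open>f = cosh s\<close>, \<open>f Z = sinh s\<close>, the addition theorem turns this into a constant step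
\<open>arsinh h\<close> of \<open>s\<close> (\<open>symmetric_tanh_recurrence\<close>). With a smooth profile curve it gives the catenary
equation \<open>f f'' = f'\<^sup>2 + 1\<close> (\<open>minimal_turned_curve_imp_cosh\<close>).

The discrete isothermic catenoid is integrated in closed form, because its edge vectors are
differences of \<open>cosh\<close> and \<open>sinh\<close> of complex arguments (\<open>BP_edge_exp\<close>).

For the variational catenoids with smooth profile curve, the first variation of the area yields the
Euler-Lagrange equation, which is the catenary equation \<open>x x'' = x'\<^sup>2 + \<beta>\<^sup>2\<close>
(\<open>stationary_imp_catenary_equation\<close>). The initial values at the neck select the solution
\<open>cosh (\<beta> t)\<close> (\<open>catenary_equation_solution\<close>).\<close>

section \<open>Coordinates in three-space\<close>

lemma vec3_eq_iff: "u = v \<longleftrightarrow> u $ 1 = v $ 1 \<and> u $ 2 = v $ 2 \<and> u $ 3 = v $ 3"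
  for u v :: "'a^3"
  by (simp add: vec_eq_iff forall_3)

lemma inner_vec3: "u \<bullet> v = u $ 1 * v $ 1 + u $ 2 * v $ 2 + u $ 3 * v $ 3"
  for u v :: "real^3"
  by (simp add: inner_vec_def sum_3)

lemma norm_vec3_squared: "(norm u)\<^sup>2 = (u $ 1)\<^sup>2 + (u $ 2)\<^sup>2 + (u $ 3)\<^sup>2"
  for u :: "real^3"
  unfolding power2_norm_eq_inner inner_vec3 by (simp add: power2_eq_square)

lemma polar_squares: "(a * cos t)\<^sup>2 + (a * sin t)\<^sup>2 = a\<^sup>2" for a t :: real
  by (simp add: power_mult_distrib flip: distrib_left)

lemma has_vector_derivative_vec3:
  fixes f g h :: "real \<Rightarrow> real"
  assumes "(f has_vector_derivative f') (at t)" "(g has_vector_derivative g') (at t)"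
    "(h has_vector_derivative h') (at t)"
  shows "((\<lambda>t. vector [f t, g t, h t] :: real^3) has_vector_derivative vector [f', g', h']) (at t)"
proof -
  have eq: "vector [a, b, c] = a *\<^sub>R axis 1 1 + b *\<^sub>R axis 2 1 + c *\<^sub>R (axis 3 1 :: real^3)" for a b c
    by (simp add: vec3_eq_iff axis_def)
  show ?thesis
    unfolding eq
    by (intro has_vector_derivative_add assms
        bounded_linear.has_vector_derivative[OF bounded_linear_scaleR_left])
qed

section \<open>Smooth functions\<close>

text \<open>Smoothness asks for an explicit sequence of all derivatives. For the concrete functions below it is
easier to exhibit a family that contains the function and is stable under differentiation.\<close>

lemma smooth_if_closed_under_derivative:
  assumes "f \<in> S"
    and closed: "\<And>g. g \<in> S \<Longrightarrow> \<exists>g' \<in> S. \<forall>t. (g has_vector_derivative g' t) (at t)"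
  shows "smooth f"
proof -
  from closed obtain d
    where d: "\<And>g. g \<in> S \<Longrightarrow> d g \<in> S \<and> (\<forall>t. (g has_vector_derivative d g t) (at t))"
    by metis
  define D where "D n = (d ^^ n) f" for n
  have "D n \<in> S" for n
    unfolding D_def by (induction n) (use \<open>f \<in> S\<close> d in auto)
  then have "(D n has_vector_derivative D (Suc n) t) (at t)" for n t
    using d by (simp add: D_def)
  then show ?thesis
    unfolding smooth_def by (intro exI[of _ D]) (simp add: D_def)
qed

lemma smooth_derivative:
  fixes f :: "real \<Rightarrow> real"
  assumes "smooth f"
  shows "(f has_real_derivative deriv f t) (at t)" and "smooth (deriv f)"
proof -
  from assms obtain D
    where D: "D 0 = f" "\<And>n t. (D n has_vector_derivative D (Suc n) t) (at t)"
    unfolding smooth_def by blast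
  then have f': "(f has_real_derivative D 1 t) (at t)" for t
    using D(2)[of 0] by (simp add: has_real_derivative_iff_has_vector_derivative)
  then have "deriv f = D 1"
    by (intro ext DERIV_imp_deriv)
  with f' show "(f has_real_derivative deriv f t) (at t)"
    by simp
  show "smooth (deriv f)"
    unfolding smooth_def using D(2) \<open>deriv f = D 1\<close> by (intro exI[of _ "\<lambda>n. D (Suc n)"]) simp
qed

lemma smooth_poly: "smooth (poly p)" for p :: "real poly"
proof (rule smooth_if_closed_under_derivative[where S = "range poly"])
  fix g :: "real \<Rightarrow> real" assume "g \<in> range poly"
  then obtain p where "g = poly p" by blast
  then have "\<forall>t. (g has_vector_derivative poly (pderiv p) t) (at t)"
    by (simp flip: has_real_derivative_iff_has_vector_derivative)
  then show "\<exists>g'\<in>range poly. \<forall>t. (g has_vector_derivative g' t) (at t)"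
    by blast
qed simp

lemma smooth_const: "smooth (\<lambda>_. c)" for c :: real
proof -
  have "poly [:c:] = (\<lambda>_. c)"
    by (simp add: fun_eq_iff)
  then show ?thesis
    using smooth_poly by metis
qed

lemma smooth_ident: "smooth (\<lambda>t. t :: real)"
proof -
  have "poly [:0, 1:] = (\<lambda>t. t :: real)"
    by (simp add: fun_eq_iff)
  then show ?thesis
    using smooth_poly by metis
qed

lemma smooth_sinusoid: "smooth (\<lambda>t. a * cos t + b * sin t)" for a b :: real
proof (rule smooth_if_closed_under_derivative[where S = "{\<lambda>t. a * cos t + b * sin t | a b. True}"])
  fix g :: "real \<Rightarrow> real" assume "g \<in> {\<lambda>t. a * cos t + b * sin t | a b. True}"
  then obtain a b where g: "g = (\<lambda>t. a * cos t + b * sin t)" by blast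
  have "(g has_vector_derivative b * cos t + (- a) * sin t) (at t)" for t
    unfolding g has_real_derivative_iff_has_vector_derivative[symmetric]
    by (auto intro!: derivative_eq_intros)
  then show "\<exists>g' \<in> {\<lambda>t. a * cos t + b * sin t | a b. True}.
      \<forall>t. (g has_vector_derivative g' t) (at t)"
    by (intro bexI[of _ "\<lambda>t. b * cos t + (- a) * sin t"]) blast+
qed blast

lemma smooth_hyperbolic: "smooth (\<lambda>t. a * cosh (c * t) + b * sinh (c * t))" for a b c :: real
proof (rule smooth_if_closed_under_derivative
    [where S = "{\<lambda>t. a * cosh (c * t) + b * sinh (c * t) | a b. True}"])
  fix g :: "real \<Rightarrow> real" assume "g \<in> {\<lambda>t. a * cosh (c * t) + b * sinh (c * t) | a b. True}"
  then obtain a b where g: "g = (\<lambda>t. a * cosh (c * t) + b * sinh (c * t))" by blast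
  have "(g has_vector_derivative (c * b) * cosh (c * t) + (c * a) * sinh (c * t)) (at t)" for t
    unfolding g has_real_derivative_iff_has_vector_derivative[symmetric]
    by (auto intro!: derivative_eq_intros simp: algebra_simps)
  then show "\<exists>g' \<in> {\<lambda>t. a * cosh (c * t) + b * sinh (c * t) | a b. True}.
      \<forall>t. (g has_vector_derivative g' t) (at t)"
    by (intro bexI[of _ "\<lambda>t. (c * b) * cosh (c * t) + (c * a) * sinh (c * t)"]) blast+
qed blast

lemma smooth_cosh: "smooth (\<lambda>t. cosh (c * t))" for c :: real
  using smooth_hyperbolic[of 1 c 0] by simp

text \<open>Since \<open>tanh' = 1 - tanh\<^sup>2\<close> and \<open>(1 / cosh)' = - tanh / cosh\<close>, the functions of this shape are stable
under differentiation. They contain the coordinates of the dual catenoids.\<close>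

lemma smooth_tanh_sech:
  "smooth (\<lambda>t. poly P (tanh t) + poly Q (tanh t) / cosh t)" (is "smooth (?F P Q)") for P Q :: "real poly"
proof (rule smooth_if_closed_under_derivative[where S = "{?F P Q | P Q. True}"])
  fix g :: "real \<Rightarrow> real" assume "g \<in> {?F P Q | P Q. True}"
  then obtain P Q where g: "g = ?F P Q" by blast
  let ?P = "pderiv P * [:1, 0, -1:]" and ?Q = "pderiv Q * [:1, 0, -1:] - [:0, 1:] * Q"
  have "(g has_vector_derivative ?F ?P ?Q t) (at t)" for t
    unfolding g has_real_derivative_iff_has_vector_derivative[symmetric]
    by (auto intro!: derivative_eq_intros DERIV_chain'[of tanh, OF _ poly_DERIV] 
        simp: field_simps tanh_def power2_eq_square)
  then show "\<exists>g' \<in> {?F P Q | P Q. True}. \<forall>t. (g has_vector_derivative g' t) (at t)"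
    by (intro bexI[of _ "?F ?P ?Q"]) blast+
qed blast

lemma smooth_vec3:
  assumes "smooth f" "smooth g" "smooth h"
  shows "smooth (\<lambda>t. vector [f t, g t, h t] :: real^3)"
proof -
  from assms obtain D E F
    where "D 0 = f" "E 0 = g" "F 0 = h"
      and "\<And>n t. (D n has_vector_derivative D (Suc n) t) (at t)"
      and "\<And>n t. (E n has_vector_derivative E (Suc n) t) (at t)"
      and "\<And>n t. (F n has_vector_derivative F (Suc n) t) (at t)"
    unfolding smooth_def by metis
  then show ?thesis
    unfolding smooth_def
    by (intro exI[of _ "\<lambda>n t. vector [D n t, E n t, F n t]"]) (simp add: has_vector_derivative_vec3)
qed

lemma smooth_mult_const: "smooth (\<lambda>t. f t * c)" if "smooth f" for f :: "real \<Rightarrow> real"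
proof -
  from that obtain D where "D 0 = f" "\<And>n t. (D n has_vector_derivative D (Suc n) t) (at t)"
    unfolding smooth_def by blast
  then show ?thesis
    unfolding smooth_def
    by (intro exI[of _ "\<lambda>n t. D n t * c"]) (auto intro!: has_vector_derivative_mult_left)
qed

section \<open>The catenary equation\<close>

text \<open>By the equation, \<open>(f'\<^sup>2 + \<beta>\<^sup>2) / f\<^sup>2\<close> is a first integral; it has the value \<open>\<beta>\<^sup>2\<close> at the neck. So
\<open>f\<close> solves the linear equation \<open>f'' = \<beta>\<^sup>2 f\<close>, which factors into first-order equations for
\<open>f' + \<beta> f\<close> and \<open>f' - \<beta> f\<close>.\<close>

lemma catenary_equation_solution:
  fixes f f' f'' :: "real \<Rightarrow> real"
  assumes f': "\<And>t. (f has_real_derivative f' t) (at t)"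
    and f'': "\<And>t. (f' has_real_derivative f'' t) (at t)"
    and pos: "\<And>t. f t > 0" and "\<beta> > 0"
    and eq: "\<And>t. f t * f'' t = (f' t)\<^sup>2 + \<beta>\<^sup>2"
    and init: "f 0 = 1" "f' 0 = 0"
  shows "f t = cosh (\<beta> * t)"
proof -
  have "((\<lambda>t. ((f' t)\<^sup>2 + \<beta>\<^sup>2) / (f t)\<^sup>2) has_real_derivative 0) (at t)" for t
  proof -
    have "2 * f' t * f'' t * (f t)\<^sup>2 - ((f' t)\<^sup>2 + \<beta>\<^sup>2) * (2 * f t * f' t) = 0"
      unfolding eq[symmetric] by (simp add: power2_eq_square)
    then show ?thesis
      using pos[of t] by (auto intro!: derivative_eq_intros f' f'' simp: power2_eq_square algebra_simps)
  qed
  then have "((f' t)\<^sup>2 + \<beta>\<^sup>2) / (f t)\<^sup>2 = ((f' 0)\<^sup>2 + \<beta>\<^sup>2) / (f 0)\<^sup>2" for t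
    by (intro DERIV_isconst_all allI)
  then have "(f' t)\<^sup>2 + \<beta>\<^sup>2 = \<beta>\<^sup>2 * (f t)\<^sup>2" for t
    using pos[of t] by (simp add: init divide_simps split: if_splits)
  then have lin: "f'' t = \<beta>\<^sup>2 * f t" for t
    using eq[of t] pos[of t] by (simp add: power2_eq_square)
  have *: "f' t + \<gamma> * f t = \<gamma> * exp (\<gamma> * t)" if "\<gamma>\<^sup>2 = \<beta>\<^sup>2" for \<gamma> t
  proof -
    have "((\<lambda>t. (f' t + \<gamma> * f t) * exp (- (\<gamma> * t))) has_real_derivative 0) (at t)" for t
      using that lin[of t]
      by (auto intro!: derivative_eq_intros f' f'' simp: power2_eq_square algebra_simps)
    then have "(f' t + \<gamma> * f t) * exp (- (\<gamma> * t)) = (f' 0 + \<gamma> * f 0) * exp (- (\<gamma> * 0))"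
      by (intro DERIV_isconst_all allI)
    then show ?thesis
      by (simp add: init exp_minus field_simps)
  qed
  have "\<beta> * (2 * f t) = \<beta> * (exp (\<beta> * t) + exp (- (\<beta> * t)))"
    using *[of \<beta> t] *[of "- \<beta>" t] by (simp add: algebra_simps)
  then show ?thesis
    using \<open>\<beta> > 0\<close> by (simp add: cosh_field_def)
qed

section \<open>Circles\<close>

text \<open>The vectors \<open>v\<close> and \<open>w\<close> are, up to their lengths, mirror images in the plane bisecting \<open>p\<close> and \<open>q\<close>.
A circle through \<open>p\<close> and \<open>q\<close> whose centre lies in that plane is mapped to itself with reversed
orientation, so if it is tangent to \<open>v\<close> at \<open>p\<close> then it is tangent to \<open>w\<close> at \<open>q\<close>, with the opposite
orientation. Both rotational types of semi-discrete surfaces below have this symmetry.\<close>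

lemma oppositely_tangent_circleI:
  fixes p q v w M :: "real^3"
  assumes "p \<noteq> q" "M \<noteq> 0" and orth: "(p - q) \<bullet> M = 0" and "a > 0" "b > 0"
    and v: "v = a *\<^sub>R (M + s *\<^sub>R (p - q))" and w: "w = b *\<^sub>R (M - s *\<^sub>R (p - q))"
  shows "oppositely_tangent_circle p v q w"
proof -
  define d m where "d = norm (p - q)" and "m = norm M"
  define e1 e2 where "e1 = (1 / d) *\<^sub>R (p - q)" and "e2 = (1 / m) *\<^sub>R M"
  have pos: "d > 0" "m > 0"
    using assms by (auto simp: d_def m_def)
  then have D: "p - q = d *\<^sub>R e1" and M: "M = m *\<^sub>R e2"
    by (auto simp: e1_def e2_def)
  define R where "R = sqrt (m\<^sup>2 + (s * d)\<^sup>2)"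
  have "R > 0" and R2: "R\<^sup>2 = m\<^sup>2 + (s * d)\<^sup>2"
    using pos by (auto simp: R_def add_pos_nonneg)
  \<comment> \<open>The point \<open>p\<close> gets the angle at which the tangent has components proportional to \<open>s d\<close> and \<open>m\<close>.\<close>
  have "(m / R)\<^sup>2 + (- s * d / R)\<^sup>2 = 1"
    using \<open>R > 0\<close> pos R2 by (simp add: power_divide flip: add_divide_distrib)
  then obtain \<phi> where \<phi>: "m / R = cos \<phi>" "- s * d / R = sin \<phi>"
    using sincos_total_2pi by metis
  then have m: "m = R * cos \<phi>" and s: "s * d = - (R * sin \<phi>)"
    using \<open>R > 0\<close> by (auto simp: field_simps)
  have "cos \<phi> > 0"
    using \<phi>(1) pos \<open>R > 0\<close> by (metis divide_pos_pos)
  define r where "r = d / (2 * cos \<phi>)"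
  have d: "d = 2 * r * cos \<phi>"
    using \<open>cos \<phi> > 0\<close> by (simp add: r_def)
  define c where "c = p - r *\<^sub>R (cos \<phi> *\<^sub>R e1 + sin \<phi> *\<^sub>R e2)"
  have "q = circle_point c r e1 e2 (pi - \<phi>)"
    using D unfolding d circle_point_def c_def by (simp add: vec3_eq_iff algebra_simps)
  moreover have "p = circle_point c r e1 e2 \<phi>"
    by (simp add: circle_point_def c_def)
  moreover have sD: "s *\<^sub>R (p - q) = - (R * sin \<phi>) *\<^sub>R e1"
    by (simp add: D flip: s)
  moreover have "v = (a * R) *\<^sub>R circle_tangent e1 e2 \<phi>"
    unfolding v sD M circle_tangent_def by (simp add: m algebra_simps)
  moreover have "w = - ((b * R) *\<^sub>R circle_tangent e1 e2 (pi - \<phi>))"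
    unfolding w sD M circle_tangent_def by (simp add: m algebra_simps)
  moreover have "r > 0" "a * R > 0" "b * R > 0"
    using pos \<open>cos \<phi> > 0\<close> \<open>R > 0\<close> assms by (auto simp: r_def)
  moreover have "norm e1 = 1" "norm e2 = 1"
    using pos by (auto simp: e1_def e2_def d_def m_def)
  moreover have "e1 \<bullet> e2 = 0"
    by (simp add: e1_def e2_def orth)
  ultimately show ?thesis
    unfolding oppositely_tangent_circle_def by blast
qed

section \<open>Integrable-systems catenoids with discrete profile curve\<close>

lemma int_seq_eq_if_equal_increments:
  fixes F G :: "int \<Rightarrow> 'a::ab_group_add"
  assumes "\<And>n. F (n + 1) - F n = G (n + 1) - G n" and "F 0 = G 0"
  shows "F n = G n"
proof (induction n rule: int_induct[where k = 0])
  case base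
  then show ?case by (rule assms)
next
  case (step1 i)
  then show ?case using assms(1)[of i] by simp
next
  case (step2 i)
  then show ?case using assms(1)[of "i - 1"] by simp
qed

text \<open>The points \<open>(1 / f k, Z k)\<close> lie on a circle, which the symmetry about the neck forces to be the unit
circle. It is parametrized by \<open>(1 / cosh s, tanh s)\<close>, and
\<open>tanh u - tanh v = sinh (u - v) / (cosh u cosh v)\<close> says that the prescribed growth of \<open>Z\<close> is a
constant step \<open>arsinh h\<close> of the parameter \<open>s\<close>.\<close>

lemma symmetric_tanh_recurrence:
  fixes f Z :: "int \<Rightarrow> real"
  assumes pos: "\<And>k. f k > 0" and f0: "f 0 = 1" and even: "f (- 1) = f 1"
    and sphere: "\<And>k. (1 / f k)\<^sup>2 + (Z k)\<^sup>2 = R"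
    and step: "\<And>k. Z (k + 1) - Z k = h / (f k * f (k + 1))" and "h > 0"
  shows "f k = cosh (of_int k * arsinh h)"
proof -
  have "Z 1 = Z 0 + h / f 1" "Z (- 1) = Z 0 - h / f 1"
    using step[of 0] step[of "- 1"] by (auto simp: f0 even)
  moreover have "(Z 1)\<^sup>2 = (Z (- 1))\<^sup>2"
    using sphere[of 1] sphere[of "- 1"] by (simp add: even)
  ultimately have "(Z 0 + h / f 1)\<^sup>2 = (Z 0 - h / f 1)\<^sup>2"
    by simp
  then have "4 * (Z 0 * (h / f 1)) = 0"
    unfolding power2_sum power2_diff by linarith
  then have Z0: "Z 0 = 0"
    using \<open>h > 0\<close> pos[of 1] by simp
  then have "R = 1"
    using sphere[of 0] by (simp add: f0)
  \<comment> \<open>This is the parameter with \<open>Z k = tanh (s k)\<close> and \<open>1 / f k = 1 / cosh (s k)\<close>.\<close>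
  define s where "s k = arsinh (f k * Z k)" for k
  have sinh_s: "sinh (s k) = f k * Z k" for k
    by (simp add: s_def)
  have cosh_s: "cosh (s k) = f k" for k
  proof -
    have "(f k)\<^sup>2 = (f k * Z k)\<^sup>2 + 1"
      using sphere[of k] pos[of k] \<open>R = 1\<close>
      by (simp add: field_simps)
    then show ?thesis
      using pos[of k] by (simp add: s_def cosh_arsinh_real real_sqrt_unique)
  qed
  have "sinh (s (k + 1) - s k) = h" for k
  proof -
    have "sinh (s (k + 1) - s k) = f k * f (k + 1) * (Z (k + 1) - Z k)"
      unfolding sinh_diff sinh_s cosh_s by (simp add: algebra_simps)
    then show ?thesis
      using pos[of k] pos[of "k + 1"] by (simp add: step)
  qed
  then have s_step: "s (k + 1) = s k + arsinh h" for k
    by (metis arsinh_sinh_real add.commute diff_add_cancel)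
  have "s 0 = 0"
    by (simp add: s_def Z0)
  have "s k = of_int k * arsinh h"
    by (rule int_seq_eq_if_equal_increments[of s]) (simp_all add: s_step distrib_right \<open>s 0 = 0\<close>)
  then show ?thesis
    using cosh_s by metis
qed

text \<open>Both the catenoids with discrete profile curve, smooth in the direction of rotation, and their duals
are of this form; for the duals \<open>f\<close> is negative.\<close>

definition stacked_circles :: "(int \<Rightarrow> real) \<Rightarrow> (int \<Rightarrow> real) \<Rightarrow> semi_discrete" where
  "stacked_circles f Z k t = vector [f k * cos t, f k * sin t, Z k]"

lemma stacked_circles_derivative:
  "(stacked_circles f Z k has_vector_derivative vector [- f k * sin t, f k * cos t, 0]) (at t)"
  unfolding stacked_circles_def
  by (rule has_vector_derivative_vec3;
      simp flip: has_real_derivative_iff_has_vector_derivative;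
      auto intro!: derivative_eq_intros)

lemma del_stacked_circles: "del (stacked_circles f Z) k t = vector [- f k * sin t, f k * cos t, 0]"
  unfolding del_def by (rule vector_derivative_at[OF stacked_circles_derivative])

lemma stacked_circles_surface: "semi_discrete_surface (stacked_circles f Z)"
  unfolding semi_discrete_surface_def stacked_circles_def
  using smooth_sinusoid[of "f _" 0] smooth_sinusoid[of 0 "f _"]
  by (intro allI smooth_vec3 smooth_const) auto

lemma stacked_circles_conjugate: "conjugate (stacked_circles f Z)"
proof -
  have "\<exists>a b c. (a, b, c) \<noteq> (0, 0, 0) \<and>
      a *\<^sub>R del (stacked_circles f Z) k t + b *\<^sub>R Delta (stacked_circles f Z) k t +
      c *\<^sub>R Delta (del (stacked_circles f Z)) k t = 0" for k t
  proof (cases "f k = 0")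
    case True
    then show ?thesis
      by (intro exI[of _ 1] exI[of _ 0]) (simp add: del_stacked_circles vec3_eq_iff)
  next
    case False
    then show ?thesis
      by (intro exI[of _ "f (k + 1) - f k"] exI[of _ 0] exI[of _ "- f k"])
        (simp add: del_stacked_circles Delta_def vec3_eq_iff algebra_simps)
  qed
  then show ?thesis
    using stacked_circles_surface by (auto simp: conjugate_def)
qed

lemma norm_Delta_stacked_circles:
  "(norm (Delta (stacked_circles f Z) k t))\<^sup>2 = (f (k + 1) - f k)\<^sup>2 + (Z (k + 1) - Z k)\<^sup>2"
  using polar_squares[of "f (k + 1) - f k" t]
  unfolding norm_vec3_squared Delta_def stacked_circles_def by (simp add: left_diff_distrib)

lemma norm_del_stacked_circles: "(norm (del (stacked_circles f Z) k t))\<^sup>2 = (f k)\<^sup>2"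
  using polar_squares[of "f k" t]
  unfolding norm_vec3_squared del_stacked_circles by simp

text \<open>The two circles have parallel tangents orthogonal to the joining edge, so that edge is a diameter of
the required circle.\<close>

lemma stacked_circles_circular:
  assumes "\<And>k. f k > 0" and "\<And>k. Z (k + 1) \<noteq> Z k"
  shows "circular (stacked_circles f Z)"
proof -
  have "oppositely_tangent_circle (stacked_circles f Z k t) (del (stacked_circles f Z) k t)
      (stacked_circles f Z (k + 1) t) (del (stacked_circles f Z) (k + 1) t)" for k t
  proof (rule oppositely_tangent_circleI
      [where M = "vector [- sin t, cos t, 0]" and s = 0 and a = "f k" and b = "f (k + 1)"])
    have "(vector [- sin t, cos t, 0] :: real^3) \<bullet> vector [- sin t, cos t, 0] = 1"
      by (simp add: inner_vec3 flip: power2_eq_square)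
    then show "(vector [- sin t, cos t, 0] :: real^3) \<noteq> 0"
      by (metis inner_zero_left zero_neq_one)
    show "stacked_circles f Z k t \<noteq> stacked_circles f Z (k + 1) t"
      using assms(2)[of k] by (auto simp: stacked_circles_def vec3_eq_iff)
  qed (use assms(1) in \<open>auto simp: del_stacked_circles vec3_eq_iff inner_vec3 stacked_circles_def
      algebra_simps\<close>)
  then show ?thesis
    by (simp add: circular_def stacked_circles_surface)
qed

lemma tanh_diff_eq: "tanh u - tanh v = sinh (u - v) / (cosh v * cosh u)" for u v :: real
  by (simp add: sinh_diff tanh_def field_simps)

text \<open>The dual surface is \<open>(- cos t / cosh (k a), - sin t / cosh (k a), tanh (k a))\<close>, which lies on the
unit sphere.\<close>

lemma cosh_profile_minimal:
  assumes "h > 0"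
  defines "a \<equiv> arsinh h"
  shows "minimal (stacked_circles (\<lambda>k. cosh (of_int k * a)) (\<lambda>k. h * of_int k))"
proof -
  define f where "f k = cosh (of_int k * a)" for k :: int
  let ?x = "stacked_circles f (\<lambda>k. h * of_int k)"
  let ?y = "stacked_circles (\<lambda>k. - 1 / f k) (\<lambda>k. tanh (of_int k * a))"
  let ?\<nu> = "\<lambda>k t. f k :: real"
  have f: "f k > 0" for k
    by (simp add: f_def)
  have "isothermic_wrt ?x ?\<nu>"
    unfolding isothermic_wrt_def
  proof (intro conjI exI[of _ "\<lambda>k. ((f (k + 1) - f k)\<^sup>2 + h\<^sup>2) / (f k * f (k + 1))"]
      exI[of _ "\<lambda>_. 1"] allI)
    show "circular ?x"
      using f \<open>h > 0\<close> by (intro stacked_circles_circular) auto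
    fix k t
    show "0 < ((f (k + 1) - f k)\<^sup>2 + h\<^sup>2) / (f k * f (k + 1))"
      using f \<open>h > 0\<close> by (auto intro!: divide_pos_pos add_nonneg_pos)
    show "(norm (Delta ?x k t))\<^sup>2 = ((f (k + 1) - f k)\<^sup>2 + h\<^sup>2) / (f k * f (k + 1)) * f k * f (k + 1)"
      using f[of k] f[of "k + 1"] unfolding norm_Delta_stacked_circles
      by (simp add: field_simps)
    show "(norm (del ?x k t))\<^sup>2 = 1 * (f k)\<^sup>2"
      by (simp add: norm_del_stacked_circles)
  qed (use f in auto)
  moreover have "dual_wrt ?\<nu> ?x ?y"
    unfolding dual_wrt_def
  proof (intro conjI allI stacked_circles_conjugate)
    fix k t
    show "del ?y k t = - ((1 / (f k)\<^sup>2) *\<^sub>R del ?x k t)"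
      using f[of k] by (simp add: del_stacked_circles vec3_eq_iff power2_eq_square)
    have "tanh (of_int (k + 1) * a) - tanh (of_int k * a) = h / (f k * f (k + 1))"
      unfolding tanh_diff_eq f_def by (simp add: a_def algebra_simps)
    then show "Delta ?y k t = (1 / (f k * f (k + 1))) *\<^sub>R Delta ?x k t"
      using f[of k] f[of "k + 1"]
      by (simp add: Delta_def stacked_circles_def vec3_eq_iff field_simps)
  qed
  moreover have "?y k t \<in> sphere 0 1" for k t
  proof -
    have "(norm (?y k t))\<^sup>2 = (- 1 / f k)\<^sup>2 + (tanh (of_int k * a))\<^sup>2"
      using polar_squares[of "- 1 / f k" t] unfolding norm_vec3_squared stacked_circles_def by simp
    also have "\<dots> = 1"
      using f[of k]
      by (simp add: tanh_def power_divide sinh_square_eq f_def flip: add_divide_distrib)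
    finally show ?thesis
      by (simp add: norm_eq_1 power2_norm_eq_inner)
  qed
  ultimately show ?thesis
    unfolding minimal_def f_def by (intro exI[of _ ?\<nu>] exI[of _ ?y] exI[of _ 0] exI[of _ 1]) (auto simp: f_def)
qed

text \<open>The isothermic condition gives \<open>\<nu> = f / sqrt \<tau>\<close>, where \<open>\<tau>\<close> is constant since the edge lengths do not
depend on \<open>t\<close>. With \<open>Y\<close> the dual relative to the centre of its sphere, differentiating \<open>|Y|\<^sup>2 = r\<^sup>2\<close>
once shows that \<open>Y\<close> is orthogonal to the circles of the surface, and differentiating this relation
gives the radial component of \<open>Y\<close>. So the horizontal part of \<open>Y\<close> has length \<open>\<tau> / f\<close>, and the sphere
equation becomes the circle equation of \<open>symmetric_tanh_recurrence\<close>.\<close>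

lemma minimal_stacked_circles_imp_cosh:
  assumes minimal: "minimal (stacked_circles f (\<lambda>k. h * of_int k))"
    and "h > 0" and f: "\<And>k. f k > 0" and f0: "f 0 = 1" and even: "f (- 1) = f 1"
  shows "f k = cosh (of_int k * arsinh h)"
proof -
  let ?x = "stacked_circles f (\<lambda>k. h * of_int k)"
  obtain \<nu> y C r where iso: "isothermic_wrt ?x \<nu>" and dual: "dual_wrt \<nu> ?x y"
    and sphere: "\<And>k t. y k t \<in> sphere C r"
    using minimal unfolding minimal_def by blast
  have norm_Delta: "(norm (Delta ?x k t))\<^sup>2 = (f (k + 1) - f k)\<^sup>2 + h\<^sup>2" for k t
    unfolding norm_Delta_stacked_circles by (simp add: algebra_simps)
  obtain \<sigma> \<tau> where \<nu>: "\<And>k t. \<nu> k t > 0" and \<sigma>: "\<And>k. \<sigma> k > 0" and \<tau>: "\<And>t. \<tau> t > 0"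
    and Delta2: "\<And>k t. (f (k + 1) - f k)\<^sup>2 + h\<^sup>2 = \<sigma> k * \<nu> k t * \<nu> (k + 1) t"
    and del2: "\<And>k t. (f k)\<^sup>2 = \<tau> t * (\<nu> k t)\<^sup>2"
    using iso unfolding isothermic_wrt_def norm_Delta norm_del_stacked_circles by blast
  have f_eq: "f k = sqrt (\<tau> t) * \<nu> k t" for k t
    using f[of k] \<nu>[of k t] del2[of k t] by (metis abs_of_pos real_sqrt_abs real_sqrt_mult)
  have prod: "\<nu> k t * \<nu> l t = f k * f l / \<tau> t" for k l t
    using f_eq[of k t] f_eq[of l t] \<tau>[of t] by (simp add: field_simps)
  have "\<tau> t = \<tau> 0" for t
  proof -
    have "\<sigma> 0 * (f 0 * f 1 / \<tau> t) = \<sigma> 0 * (f 0 * f 1 / \<tau> 0)"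
      using Delta2[of 0 t] Delta2[of 0 0] by (simp add: mult.assoc flip: prod)
    then show ?thesis
      using \<sigma>[of 0] f[of 0] f[of 1] \<tau>[of t] \<tau>[of 0] by (simp add: field_simps)
  qed
  then have prod: "\<nu> k t * \<nu> l t = f k * f l / \<tau> 0" for k l t
    using prod by metis
  define T where "T = \<tau> 0"
  have "T > 0"
    by (simp add: T_def \<tau>)
  define Y where "Y k t = y k t - C" for k t
  have Y': "(Y k has_vector_derivative
      vector [T / f k * sin t, - T / f k * cos t, 0]) (at t)" for k t
  proof -
    have "smooth (y k)"
      using dual by (simp add: dual_wrt_def conjugate_def semi_discrete_surface_def)
    then have "(y k has_vector_derivative del y k t) (at t)"
      unfolding smooth_def del_def by (metis vector_derivative_at)
    moreover have "del y k t = vector [T / f k * sin t, - T / f k * cos t, 0]"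
      using dual f[of k] prod[of k t k]
      by (simp add: dual_wrt_def del_stacked_circles vec3_eq_iff power2_eq_square T_def)
    ultimately show ?thesis
      unfolding Y_def by (auto intro!: derivative_eq_intros)
  qed
  have comp: "((\<lambda>t. Y k t $ i) has_real_derivative
      vector [T / f k * sin t, - T / f k * cos t, 0] $ i) (at t)" for k i t
    using bounded_linear.has_vector_derivative[OF bounded_linear_vec_nth Y']
    by (simp add: has_real_derivative_iff_has_vector_derivative)
  have norm_Y: "(Y k t $ 1)\<^sup>2 + (Y k t $ 2)\<^sup>2 + (Y k t $ 3)\<^sup>2 = r\<^sup>2" for k t
    using sphere[of k t] unfolding norm_vec3_squared[symmetric] Y_def
    by (simp add: dist_norm norm_minus_commute)
  \<comment> \<open>Orthogonality of the dual to the circles, from the derivative of the sphere equation.\<close>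
  have orth: "Y k t $ 1 * sin t = Y k t $ 2 * cos t" for k t
  proof -
    have "((\<lambda>t. (Y k t $ 1)\<^sup>2 + (Y k t $ 2)\<^sup>2 + (Y k t $ 3)\<^sup>2) has_real_derivative
        2 * T / f k * (Y k t $ 1 * sin t - Y k t $ 2 * cos t)) (at t)"
      by (auto intro!: derivative_eq_intros comp simp: algebra_simps)
    then have "2 * T / f k * (Y k t $ 1 * sin t - Y k t $ 2 * cos t) = 0"
      unfolding norm_Y by (metis DERIV_const DERIV_unique)
    then show ?thesis
      using f[of k] \<open>T > 0\<close> by simp
  qed
  have Y2: "Y k 0 $ 2 = 0" for k
    using orth[of k 0] by simp
  have Y1: "Y k 0 $ 1 = - T / f k" for k
  proof -
    have "((\<lambda>t. Y k t $ 1 * sin t - Y k t $ 2 * cos t) has_real_derivative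
        Y k 0 $ 1 + T / f k) (at 0)"
      by (auto intro!: derivative_eq_intros comp)
    then have "Y k 0 $ 1 + T / f k = 0"
      unfolding orth by (simp add: DERIV_unique[OF _ DERIV_const])
    then show ?thesis by simp
  qed
  have Y3: "Y (k + 1) 0 $ 3 - Y k 0 $ 3 = T * h / (f k * f (k + 1))" for k
  proof -
    have "Delta y k 0 = (T / (f k * f (k + 1))) *\<^sub>R Delta ?x k 0"
      using dual prod[of k 0 "k + 1"] by (simp add: dual_wrt_def T_def)
    moreover have "Delta ?x k 0 $ 3 = h"
      by (simp add: Delta_def stacked_circles_def algebra_simps)
    ultimately have "Delta y k 0 $ 3 = T * h / (f k * f (k + 1))"
      by simp
    then show ?thesis
      by (simp add: Delta_def Y_def)
  qed
  show ?thesis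
  proof (rule symmetric_tanh_recurrence[where Z = "\<lambda>k. Y k 0 $ 3 / T" and R = "r\<^sup>2 / T\<^sup>2"])
    show "(1 / f k)\<^sup>2 + (Y k 0 $ 3 / T)\<^sup>2 = r\<^sup>2 / T\<^sup>2" for k
      using norm_Y[of k 0] f[of k] \<open>T > 0\<close> by (simp add: Y1 Y2 field_simps)
    show "Y (k + 1) 0 $ 3 / T - Y k 0 $ 3 / T = h / (f k * f (k + 1))" for k
      using Y3[of k] \<open>T > 0\<close> by (simp flip: diff_divide_distrib)
  qed (use assms in auto)
qed

lemma MW_pd_rs_catenoid_iff:
  "MW_pd_rs_catenoid h f \<longleftrightarrow> h > 0 \<and> f = (\<lambda>k. cosh (of_int k * arsinh h))"
proof -
  have "minimal (\<lambda>k t. vector [f k * cos t, f k * sin t, h * of_int k]) \<longleftrightarrow>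
      minimal (stacked_circles f (\<lambda>k. h * of_int k))" for f
    by (simp add: stacked_circles_def[abs_def])
  then show ?thesis
    unfolding MW_pd_rs_catenoid_def
    using minimal_stacked_circles_imp_cosh cosh_profile_minimal by (auto simp: fun_eq_iff)
qed

section \<open>Integrable-systems catenoids with smooth profile curve\<close>

text \<open>Both the catenoids with smooth profile curve, discrete in the direction of rotation, and their duals
are of this form.\<close>

definition turned_curve :: "real \<Rightarrow> (real \<Rightarrow> real) \<Rightarrow> (real \<Rightarrow> real) \<Rightarrow> semi_discrete" where
  "turned_curve \<alpha> f z k t = vector [f t * cos (\<alpha> * of_int k), f t * sin (\<alpha> * of_int k), z t]"

lemma del_turned_curve:
  assumes "(f has_real_derivative f') (at t)" "(z has_real_derivative z') (at t)"
  shows "del (turned_curve \<alpha> f z) k t =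
    vector [f' * cos (\<alpha> * of_int k), f' * sin (\<alpha> * of_int k), z']"
  unfolding del_def turned_curve_def
  using assms
  by (intro vector_derivative_at has_vector_derivative_vec3;
      simp flip: has_real_derivative_iff_has_vector_derivative;
      auto intro!: derivative_eq_intros)

lemma turned_curve_surface:
  assumes "smooth f" "smooth z"
  shows "semi_discrete_surface (turned_curve \<alpha> f z)"
  unfolding semi_discrete_surface_def turned_curve_def
  by (intro allI smooth_vec3 smooth_mult_const assms)

lemma turned_curve_conjugate:
  assumes "smooth f" "smooth z"
  shows "conjugate (turned_curve \<alpha> f z)"
proof -
  let ?x = "turned_curve \<alpha> f z"
  have del: "del ?x k t =
      vector [deriv f t * cos (\<alpha> * of_int k), deriv f t * sin (\<alpha> * of_int k), deriv z t]" for k t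
    using assms by (intro del_turned_curve smooth_derivative)
  have "\<exists>a b c. (a, b, c) \<noteq> (0, 0, 0) \<and>
      a *\<^sub>R del ?x k t + b *\<^sub>R Delta ?x k t + c *\<^sub>R Delta (del ?x) k t = 0" for k t
  proof (cases "f t = 0")
    case True
    then show ?thesis
      by (intro exI[of _ 0] exI[of _ 1]) (simp add: Delta_def turned_curve_def vec3_eq_iff)
  next
    case False
    then show ?thesis
      by (intro exI[of _ 0] exI[of _ "deriv f t"] exI[of _ "- f t"])
        (simp add: del Delta_def turned_curve_def vec3_eq_iff algebra_simps)
  qed
  then show ?thesis
    using turned_curve_surface[OF assms] by (auto simp: conjugate_def)
qed

lemma cos_neq_1_iff: "cos \<alpha> \<noteq> 1 \<longleftrightarrow> (\<forall>j::int. \<alpha> \<noteq> 2 * pi * of_int j)"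
  by (auto simp: cos_one_2pi_int algebra_simps)

lemma norm_Delta_turned_curve:
  "(norm (Delta (turned_curve \<alpha> f z) k t))\<^sup>2 = 2 * (1 - cos \<alpha>) * (f t)\<^sup>2"
proof -
  have chord: "(cos v - cos u)\<^sup>2 + (sin v - sin u)\<^sup>2 = 2 * (1 - cos (v - u))" for u v :: real
    using sin_cos_squared_add[of u] sin_cos_squared_add[of v]
    unfolding power2_diff cos_diff by (simp add: algebra_simps)
  have "(norm (Delta (turned_curve \<alpha> f z) k t))\<^sup>2 =
      (f t)\<^sup>2 * ((cos (\<alpha> * of_int (k + 1)) - cos (\<alpha> * of_int k))\<^sup>2 +
               (sin (\<alpha> * of_int (k + 1)) - sin (\<alpha> * of_int k))\<^sup>2)"
    unfolding norm_vec3_squared Delta_def turned_curve_def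
    by (simp add: power_mult_distrib distrib_left flip: right_diff_distrib)
  also have "\<dots> = 2 * (1 - cos \<alpha>) * (f t)\<^sup>2"
    unfolding chord by (simp add: algebra_simps)
  finally show ?thesis .
qed

text \<open>Consecutive profile curves are mirror images in the plane bisecting the angle between them; the
difference of the tangent vectors is \<open>f' / f\<close> times the edge, and their sum lies in the mirror plane.\<close>

lemma turned_curve_circular:
  assumes "smooth f" and pos: "\<And>t. f t > 0" and "cos \<alpha> \<noteq> 1"
  shows "circular (turned_curve \<alpha> f (\<lambda>t. t))"
proof -
  let ?x = "turned_curve \<alpha> f (\<lambda>t. t)"
  have del: "del ?x k t =
      vector [deriv f t * cos (\<alpha> * of_int k), deriv f t * sin (\<alpha> * of_int k), 1]" for k t
    using assms by (intro del_turned_curve smooth_derivative) auto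
  have "oppositely_tangent_circle (?x k t) (del ?x k t) (?x (k + 1) t) (del ?x (k + 1) t)" for k t
  proof (rule oppositely_tangent_circleI
      [where M = "(1 / 2) *\<^sub>R (del ?x k t + del ?x (k + 1) t)"
        and s = "deriv f t / (2 * f t)" and a = 1 and b = 1])
    show "?x k t \<noteq> ?x (k + 1) t"
    proof
      assume "?x k t = ?x (k + 1) t"
      then have "Delta ?x k t = 0"
        by (simp add: Delta_def)
      then show False
        using norm_Delta_turned_curve[of \<alpha> f "\<lambda>t. t" k t] pos[of t] \<open>cos \<alpha> \<noteq> 1\<close> by simp
    qed
    show "(1 / 2) *\<^sub>R (del ?x k t + del ?x (k + 1) t) \<noteq> 0"
      by (simp add: del vec3_eq_iff)
    have perp: "(F * cos u - F * cos v) * (H * (cos u + cos v)) +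
        (F * sin u - F * sin v) * (H * (sin u + sin v)) = 0" for F H u v :: real
    proof -
      have "(F * cos u - F * cos v) * (H * (cos u + cos v)) +
          (F * sin u - F * sin v) * (H * (sin u + sin v)) =
          F * H * (((cos u)\<^sup>2 + (sin u)\<^sup>2) - ((cos v)\<^sup>2 + (sin v)\<^sup>2))"
        by algebra
      then show ?thesis by simp
    qed
    show "(?x k t - ?x (k + 1) t) \<bullet> ((1 / 2) *\<^sub>R (del ?x k t + del ?x (k + 1) t)) = 0"
      using perp[of "f t" "\<alpha> * of_int k" "\<alpha> * of_int (k + 1)" "deriv f t / 2"]
      unfolding inner_vec3 del turned_curve_def by (simp add: distrib_left)
  qed (use pos[of t] in \<open>simp_all add: del turned_curve_def vec3_eq_iff field_simps\<close>)
  then show ?thesis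
    using assms by (simp add: circular_def turned_curve_surface smooth_ident)
qed

text \<open>The dual surface is obtained by turning the curve \<open>(1 / cosh t, - tanh t)\<close>, which lies on the unit
circle.\<close>

lemma turned_cosh_minimal:
  assumes "cos \<alpha> \<noteq> 1"
  shows "minimal (turned_curve \<alpha> cosh (\<lambda>t. t))"
proof -
  let ?x = "turned_curve \<alpha> cosh (\<lambda>t. t)"
  let ?y = "turned_curve \<alpha> (\<lambda>t. 1 / cosh t) (\<lambda>t. - tanh t)"
  let ?\<nu> = "\<lambda>(k :: int) t. cosh t :: real"
  have "cos \<alpha> < 1"
    using assms cos_le_one[of \<alpha>] by linarith
  have sm: "smooth cosh" "smooth (\<lambda>t. t)" "smooth (\<lambda>t. 1 / cosh t)" "smooth (\<lambda>t. - tanh t)"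
    using smooth_cosh[of 1] smooth_ident smooth_tanh_sech[of 0 "[:1:]"]
      smooth_tanh_sech[of "[:0, - 1:]" 0] by simp_all
  have del_x: "del ?x k t = vector [sinh t * cos (\<alpha> * of_int k), sinh t * sin (\<alpha> * of_int k), 1]" for k t
    by (intro del_turned_curve) (auto intro!: derivative_eq_intros)
  have del_y: "del ?y k t = vector [- sinh t / (cosh t)\<^sup>2 * cos (\<alpha> * of_int k),
      - sinh t / (cosh t)\<^sup>2 * sin (\<alpha> * of_int k), - 1 / (cosh t)\<^sup>2]" for k t
  proof (intro del_turned_curve)
    show "((\<lambda>t. 1 / cosh t) has_real_derivative - sinh t / (cosh t)\<^sup>2) (at t)"
      by (auto intro!: derivative_eq_intros simp: power2_eq_square)
    have "1 - (tanh t)\<^sup>2 = 1 / (cosh t)\<^sup>2"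
      by (simp add: tanh_def power_divide sinh_square_eq field_simps)
    then show "((\<lambda>t. - tanh t) has_real_derivative - 1 / (cosh t)\<^sup>2) (at t)"
      by (auto intro!: derivative_eq_intros)
  qed
  have "isothermic_wrt ?x ?\<nu>"
    unfolding isothermic_wrt_def
  proof (intro conjI exI[of _ "\<lambda>_ :: int. 2 * (1 - cos \<alpha>)"] exI[of _ "\<lambda>_ :: real. 1"] allI)
    show "circular ?x"
      using sm assms by (intro turned_curve_circular) auto
    show "(norm (Delta ?x k t))\<^sup>2 = 2 * (1 - cos \<alpha>) * cosh t * cosh t" for k t
      unfolding norm_Delta_turned_curve by (simp add: power2_eq_square)
    show "(norm (del ?x k t))\<^sup>2 = 1 * (cosh t)\<^sup>2" for k t
      using polar_squares[of "sinh t" "\<alpha> * of_int k"]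
      unfolding norm_vec3_squared del_x by (simp add: cosh_square_eq)
  qed (use \<open>cos \<alpha> < 1\<close> in auto)
  moreover have "dual_wrt ?\<nu> ?x ?y"
    unfolding dual_wrt_def
  proof (intro conjI allI turned_curve_conjugate sm)
    fix k t
    show "del ?y k t = - ((1 / (cosh t)\<^sup>2) *\<^sub>R del ?x k t)"
      by (simp add: del_x del_y vec3_eq_iff)
    show "Delta ?y k t = (1 / (cosh t * cosh t)) *\<^sub>R Delta ?x k t"
      by (simp add: Delta_def turned_curve_def vec3_eq_iff field_simps)
  qed
  moreover have "?y k t \<in> sphere 0 1" for k t
  proof -
    have "(norm (?y k t))\<^sup>2 = (1 / cosh t)\<^sup>2 + (tanh t)\<^sup>2"
      using polar_squares[of "1 / cosh t" "\<alpha> * of_int k"]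
      unfolding norm_vec3_squared turned_curve_def by simp
    also have "\<dots> = 1"
      by (simp add: tanh_def power_divide sinh_square_eq flip: add_divide_distrib)
    finally show ?thesis
      by (simp add: norm_eq_1 power2_norm_eq_inner)
  qed
  ultimately show ?thesis
    unfolding minimal_def by (intro exI[of _ ?\<nu>] exI[of _ ?y] exI[of _ 0] exI[of _ 1]) auto
qed

text \<open>The isothermic condition gives \<open>1 / \<nu>\<^sup>2 = \<kappa> / f\<^sup>2\<close> with a constant \<open>\<kappa>\<close>. Let \<open>Y\<close> be the dual relative
to the centre of its sphere. Three consecutive points \<open>Y (-1) t\<close>, \<open>Y 0 t\<close>, \<open>Y 1 t\<close> have equal norm,
and their horizontal differences are known; this puts the axis of the dual through the centre, that
is, the first coordinate of \<open>Y 0 t\<close> is \<open>\<kappa> / f\<close>. Differentiating \<open>|Y|\<^sup>2 = r\<^sup>2\<close> shows that \<open>Y\<close> is orthogonal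
to the profile curve, so its height is \<open>- \<kappa> f' / f\<close>. By duality the derivative of
this height is \<open>- \<kappa> / f\<^sup>2\<close>, and this is the catenary equation.\<close>

lemma minimal_turned_curve_imp_cosh:
  assumes minimal: "minimal (turned_curve \<alpha> f (\<lambda>t. t))"
    and "smooth f" and f: "\<And>t. f t > 0" and init: "f 0 = 1" "deriv f 0 = 0" and "cos \<alpha> \<noteq> 1"
  shows "f t = cosh t"
proof -
  let ?x = "turned_curve \<alpha> f (\<lambda>t. t)"
  have f': "(f has_real_derivative deriv f t) (at t)" for t
    using \<open>smooth f\<close> by (rule smooth_derivative)
  have f'': "(deriv f has_real_derivative deriv (deriv f) t) (at t)" for t
    using \<open>smooth f\<close> by (intro smooth_derivative)
  have del_x: "del ?x k t =
      vector [deriv f t * cos (\<alpha> * of_int k), deriv f t * sin (\<alpha> * of_int k), 1]" for k t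
    using f' by (intro del_turned_curve) auto
  have norm_del: "(norm (del ?x k t))\<^sup>2 = (deriv f t)\<^sup>2 + 1" for k t
    using polar_squares[of "deriv f t" "\<alpha> * of_int k"]
    unfolding norm_vec3_squared del_x by simp
  obtain \<nu> y C r where iso: "isothermic_wrt ?x \<nu>" and dual: "dual_wrt \<nu> ?x y"
    and sphere: "\<And>k t. y k t \<in> sphere C r"
    using minimal unfolding minimal_def by blast
  obtain \<sigma> \<tau> where \<nu>: "\<And>k t. \<nu> k t > 0" and \<sigma>: "\<And>k. \<sigma> k > 0" and \<tau>: "\<And>t. \<tau> t > 0"
    and Delta2: "\<And>k t. 2 * (1 - cos \<alpha>) * (f t)\<^sup>2 = \<sigma> k * \<nu> k t * \<nu> (k + 1) t"
    and del2: "\<And>k t. (deriv f t)\<^sup>2 + 1 = \<tau> t * (\<nu> k t)\<^sup>2"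
    using iso unfolding isothermic_wrt_def norm_Delta_turned_curve norm_del by blast
  have \<nu>_eq: "\<nu> k t = \<nu> 0 t" for k t
  proof -
    have "(\<nu> k t)\<^sup>2 = (\<nu> 0 t)\<^sup>2"
      using del2[of t k] del2[of t 0] \<tau>[of t] by (metis less_irrefl mult_cancel_left)
    then show ?thesis
      using \<nu>[of k t] \<nu>[of 0 t] by (metis less_imp_le power2_eq_imp_eq)
  qed
  define \<kappa> where "\<kappa> = \<sigma> 0 / (2 * (1 - cos \<alpha>))"
  have "\<kappa> > 0"
    using \<sigma>[of 0] \<open>cos \<alpha> \<noteq> 1\<close> cos_le_one[of \<alpha>] by (simp add: \<kappa>_def less_le)
  have prod: "1 / (\<nu> k t * \<nu> l t) = \<kappa> / (f t)\<^sup>2" for k l t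
    using Delta2[of t 0] \<nu>_eq[of k t] \<nu>_eq[of l t] \<nu>_eq[of 1 t] \<nu>[of 0 t] f[of t] \<open>cos \<alpha> \<noteq> 1\<close>
    by (simp add: \<kappa>_def field_simps)
  define Y where "Y k t = y k t - C" for k t
  have del_y: "del y k t = - ((\<kappa> / (f t)\<^sup>2) *\<^sub>R del ?x k t)" for k t
    using dual prod[of k t k] by (simp add: dual_wrt_def power2_eq_square)
  have Y': "(Y k has_vector_derivative - ((\<kappa> / (f t)\<^sup>2) *\<^sub>R del ?x k t)) (at t)" for k t
  proof -
    have "smooth (y k)"
      using dual by (simp add: dual_wrt_def conjugate_def semi_discrete_surface_def)
    then have "(y k has_vector_derivative del y k t) (at t)"
      unfolding smooth_def del_def by (metis vector_derivative_at)
    then show ?thesis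
      unfolding Y_def del_y by (auto intro!: derivative_eq_intros)
  qed
  have comp: "((\<lambda>t. Y k t $ i) has_real_derivative - (\<kappa> / (f t)\<^sup>2) * del ?x k t $ i) (at t)" for k i t
    using bounded_linear.has_vector_derivative[OF bounded_linear_vec_nth Y']
    by (simp add: has_real_derivative_iff_has_vector_derivative)
  have norm_Y: "(Y k t $ 1)\<^sup>2 + (Y k t $ 2)\<^sup>2 + (Y k t $ 3)\<^sup>2 = r\<^sup>2" for k t
    using sphere[of k t] unfolding norm_vec3_squared[symmetric] Y_def
    by (simp add: dist_norm norm_minus_commute)
  have orth: "Y k t \<bullet> del ?x k t = 0" for k t
  proof -
    have "((\<lambda>t. (Y k t $ 1)\<^sup>2 + (Y k t $ 2)\<^sup>2 + (Y k t $ 3)\<^sup>2) has_real_derivative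
        - 2 * \<kappa> / (f t)\<^sup>2 * (Y k t \<bullet> del ?x k t)) (at t)"
      unfolding inner_vec3
      by (auto intro!: derivative_eq_intros comp simp: algebra_simps)
    then have "- 2 * \<kappa> / (f t)\<^sup>2 * (Y k t \<bullet> del ?x k t) = 0"
      unfolding norm_Y by (metis DERIV_const DERIV_unique)
    then show ?thesis
      using f[of t] \<open>\<kappa> > 0\<close> by simp
  qed
  have Y_step: "Y (k + 1) t = Y k t + (\<kappa> / (f t)\<^sup>2) *\<^sub>R Delta ?x k t" for k t
  proof -
    have "Delta y k t = (\<kappa> / (f t)\<^sup>2) *\<^sub>R Delta ?x k t"
      using dual prod[of k t "k + 1"] by (simp add: dual_wrt_def)
    then show ?thesis
      unfolding Y_def Delta_def[of y] by (metis add_diff_cancel_left' diff_add_cancel diff_add_eq)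
  qed
  have Y1: "Y 0 t $ 1 = \<kappa> / f t" for t
  proof -
    define g p q z c s where "g = \<kappa> / f t" and "p = Y 0 t $ 1" and "q = Y 0 t $ 2"
      and "z = Y 0 t $ 3" and "c = cos \<alpha>" and "s = sin \<alpha>"
    have scale: "(\<kappa> / (f t)\<^sup>2) *\<^sub>R vector [f t * a, f t * b, 0] = (vector [g * a, g * b, 0] :: real^3)" for a b
      using f[of t] by (simp add: vec3_eq_iff g_def power2_eq_square)
    have "Delta ?x 0 t = vector [f t * (c - 1), f t * s, 0]"
      by (simp add: Delta_def turned_curve_def vec3_eq_iff c_def s_def algebra_simps)
    then have "Y 1 t = Y 0 t + vector [g * (c - 1), g * s, 0]"
      using Y_step[of 0 t] scale by simp
    then have "(p + g * (c - 1))\<^sup>2 + (q + g * s)\<^sup>2 + z\<^sup>2 = p\<^sup>2 + q\<^sup>2 + z\<^sup>2"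
      using norm_Y[of 1 t] norm_Y[of 0 t] by (simp add: p_def q_def z_def)
    moreover have "Delta ?x (- 1) t = vector [f t * (1 - c), f t * s, 0]"
      by (simp add: Delta_def turned_curve_def vec3_eq_iff c_def s_def algebra_simps)
    then have "Y 0 t = Y (- 1) t + vector [g * (1 - c), g * s, 0]"
      using Y_step[of "- 1" t] scale by simp
    then have "Y (- 1) t $ 1 = p + g * (c - 1)" "Y (- 1) t $ 2 = q - g * s" "Y (- 1) t $ 3 = z"
      by (auto simp: p_def q_def z_def algebra_simps)
    then have "(p + g * (c - 1))\<^sup>2 + (q - g * s)\<^sup>2 + z\<^sup>2 = p\<^sup>2 + q\<^sup>2 + z\<^sup>2"
      using norm_Y[of "- 1" t] norm_Y[of 0 t] by (simp add: p_def q_def z_def)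
    ultimately have "2 * p * (g * (c - 1)) + ((g * (c - 1))\<^sup>2 + (g * s)\<^sup>2) = 0"
      unfolding power2_sum power2_diff by linarith
    then have "2 * p * (g * (c - 1)) + g\<^sup>2 * ((c - 1)\<^sup>2 + s\<^sup>2) = 0"
      by (simp add: power_mult_distrib distrib_left)
    moreover have "(c - 1)\<^sup>2 + s\<^sup>2 = - 2 * (c - 1)"
      using sin_cos_squared_add[of \<alpha>] by (simp add: c_def s_def power2_diff)
    ultimately have "2 * p * (g * (c - 1)) + g\<^sup>2 * (- 2 * (c - 1)) = 0"
      by simp
    then have "2 * (c - 1) * g * (p - g) = 0"
      by (simp add: power2_eq_square algebra_simps)
    then have "p = g"
      using \<open>cos \<alpha> \<noteq> 1\<close> \<open>\<kappa> > 0\<close> f[of t] by (auto simp: c_def g_def)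
    then show ?thesis
      by (simp add: p_def g_def)
  qed
  have Y3: "Y 0 t $ 3 = - \<kappa> * (deriv f t / f t)" for t
    using orth[of 0 t] by (simp add: inner_vec3 del_x Y1)
  have eq: "f t * deriv (deriv f) t = (deriv f t)\<^sup>2 + 1\<^sup>2" for t
  proof -
    define N where "N = deriv (deriv f) t * f t - deriv f t * deriv f t"
    have "((\<lambda>t. deriv f t / f t) has_real_derivative N / (f t * f t)) (at t)"
      unfolding N_def using f[of t] by (intro DERIV_divide f' f'') simp
    then have "((\<lambda>t. Y 0 t $ 3) has_real_derivative - \<kappa> * (N / (f t * f t))) (at t)"
      unfolding Y3 by (rule DERIV_cmult)
    then have "- \<kappa> * (N / (f t * f t)) = - (\<kappa> / (f t)\<^sup>2) * 1"
      using DERIV_unique[OF _ comp[of 0 3 t]] by (simp add: del_x)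
    then have "N = 1"
      using f[of t] \<open>\<kappa> > 0\<close> by (simp add: power2_eq_square)
    then show ?thesis
      by (simp add: N_def power2_eq_square mult.commute)
  qed
  show ?thesis
    using catenary_equation_solution[OF f' f'' f _ eq init] by simp
qed

lemma MW_ps_rd_catenoid_iff:
  "MW_ps_rd_catenoid \<alpha> f \<longleftrightarrow> \<alpha> > 0 \<and> (\<forall>j::int. \<alpha> \<noteq> 2 * pi * of_int j) \<and> f = cosh"
proof -
  have "minimal (\<lambda>k t. vector [f t * cos (\<alpha> * of_int k), f t * sin (\<alpha> * of_int k), t]) \<longleftrightarrow>
      minimal (turned_curve \<alpha> f (\<lambda>t. t))" for f
    by (simp add: turned_curve_def[abs_def])
  moreover have "deriv cosh 0 = (0 :: real)"
    by (rule DERIV_imp_deriv) (auto intro!: derivative_eq_intros)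
  moreover have "smooth (cosh :: real \<Rightarrow> real)"
    using smooth_cosh[of 1] by simp
  ultimately show ?thesis
    unfolding MW_ps_rd_catenoid_def
    using minimal_turned_curve_imp_cosh turned_cosh_minimal
    by (auto simp: cos_neq_1_iff intro!: ext)
qed

section \<open>The Weierstrass-type representation of Bobenko and Pinkall\<close>

lemma complex_hyperbolic:
  "Re (cosh z) = cosh (Re z) * cos (Im z)" "Im (sinh z) = cosh (Re z) * sin (Im z)"
  "Re (sinh z) = sinh (Re z) * cos (Im z)"
  by (simp_all add: cosh_field_def sinh_field_def Re_exp Im_exp field_simps)

lemma sinh_complex_of_real: "sinh (complex_of_real x) = complex_of_real (sinh x)"
  by (simp add: sinh_field_def exp_of_real flip: of_real_minus)

text \<open>In both directions of the lattice the edge label is \<open>2 sinh\<^sup>2 d\<close>, where \<open>2 d\<close> is the difference of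
the exponents of the two values of \<open>g\<close>: real \<open>d = c1 / 2\<close> along the profile curves and
imaginary \<open>d = \<i> c2 / 2\<close> around the axis. The addition theorems then turn the quotients in the edge
vector into differences, so that the edges can be summed.\<close>

lemma BP_edge_exp:
  assumes a: "complex_of_real a = 2 * (sinh d)\<^sup>2" and "sinh d \<noteq> 0"
  shows "BP_edge a (- exp (z - d)) (- exp (z + d)) =
    vector [Re (cosh (z + d) - cosh (z - d)), Im (sinh (z + d) - sinh (z - d)), Re (sinh (2 * d))]"
proof -
  define w where "w = complex_of_real a / (- exp (z + d) - - exp (z - d))"
  have "- exp (z + d) - - exp (z - d) = - (2 * sinh d * exp z)"
    by (simp add: sinh_field_def exp_add exp_diff exp_minus field_simps)
  then have w: "w = - sinh d * exp (- z)"
    unfolding w_def a using \<open>sinh d \<noteq> 0\<close>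
    by (simp only:) (simp add: power2_eq_square exp_minus field_simps)
  have prod: "- exp (z + d) * - exp (z - d) = exp z * exp z"
    by (simp flip: exp_add)
  have "w * (1 - - exp (z + d) * - exp (z - d)) = cosh (z + d) - cosh (z - d)"
    unfolding prod w cosh_add cosh_diff
    by (simp add: sinh_field_def[of z] exp_minus field_simps)
  moreover have "w * (\<i> + \<i> * - exp (z + d) * - exp (z - d)) = - \<i> * (sinh (z + d) - sinh (z - d))"
    using prod unfolding w sinh_add sinh_diff
    by (simp add: cosh_field_def[of z] mult.assoc exp_minus field_simps)
  moreover have "w * (- exp (z + d) + - exp (z - d)) = sinh (2 * d)"
    unfolding w sinh_double
    by (simp add: cosh_field_def[of d] exp_minus exp_add exp_diff field_simps)
  ultimately show ?thesis
    unfolding BP_edge_def Let_def w_def[symmetric] by (simp only:) simp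
qed

text \<open>These are \<open>Re (cosh z)\<close>, \<open>Im (sinh z)\<close> and a multiple of \<open>Re z\<close> for \<open>z = c1 n + \<i> c2 m\<close>.\<close>

definition BP_map :: "real \<Rightarrow> real \<Rightarrow> int \<times> int \<Rightarrow> real^3" where
  "BP_map c1 c2 = (\<lambda>(n, m).
     vector [cosh (of_int n * c1) * cos (of_int m * c2), cosh (of_int n * c1) * sin (of_int m * c2),
       of_int n * sinh c1])"

lemma BP_edge_map:
  assumes "c1 > 0" and c2: "\<And>j::int. c2 \<noteq> 2 * pi * of_int j"
  shows "BP_edge (2 * (sinh (c1 / 2))\<^sup>2) (BP_g c1 c2 (n, m)) (BP_g c1 c2 (n + 1, m)) =
      BP_map c1 c2 (n + 1, m) - BP_map c1 c2 (n, m)"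
    and "BP_edge (- 2 * (sin (c2 / 2))\<^sup>2) (BP_g c1 c2 (n, m)) (BP_g c1 c2 (n, m + 1)) =
      BP_map c1 c2 (n, m + 1) - BP_map c1 c2 (n, m)"
proof -
  have g: "BP_g c1 c2 (n, m) = - exp (Complex (c1 * of_int n) (c2 * of_int m))" for n m
    by (simp add: BP_g_def Complex_eq)
  define z d where "z = Complex (c1 * (of_int n + 1 / 2)) (c2 * of_int m)" and
    "d = complex_of_real (c1 / 2)"
  have "sinh d = complex_of_real (sinh (c1 / 2))"
    unfolding d_def by (rule sinh_complex_of_real)
  then have "complex_of_real (2 * (sinh (c1 / 2))\<^sup>2) = 2 * (sinh d)\<^sup>2" "sinh d \<noteq> 0"
    using \<open>c1 > 0\<close> by simp_all
  moreover have "z - d = Complex (c1 * of_int n) (c2 * of_int m)"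
    "z + d = Complex (c1 * of_int (n + 1)) (c2 * of_int m)"
    by (simp_all add: z_def d_def complex_eq_iff algebra_simps)
  moreover have "Re (sinh (2 * d)) = sinh c1"
    by (simp add: d_def complex_hyperbolic)
  ultimately show "BP_edge (2 * (sinh (c1 / 2))\<^sup>2) (BP_g c1 c2 (n, m)) (BP_g c1 c2 (n + 1, m)) =
      BP_map c1 c2 (n + 1, m) - BP_map c1 c2 (n, m)"
    using BP_edge_exp[of _ d z] by (simp add: g BP_map_def vec3_eq_iff complex_hyperbolic algebra_simps)
next
  have g: "BP_g c1 c2 (n, m) = - exp (Complex (c1 * of_int n) (c2 * of_int m))" for n m
    by (simp add: BP_g_def Complex_eq)
  define z d where "z = Complex (c1 * of_int n) (c2 * (of_int m + 1 / 2))" and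
    "d = \<i> * complex_of_real (c2 / 2)"
  have "sin (c2 / 2) \<noteq> 0"
  proof
    assume "sin (c2 / 2) = 0"
    then obtain j :: int where "c2 / 2 = of_int j * pi"
      by (auto simp: sin_zero_iff_int2)
    then show False
      using c2[of j] by simp
  qed
  have sinh_d: "sinh d = \<i> * complex_of_real (sin (c2 / 2))"
    unfolding d_def by (simp add: sinh_conv_sin flip: sin_of_real)
  then have "complex_of_real (- 2 * (sin (c2 / 2))\<^sup>2) = 2 * (sinh d)\<^sup>2" "sinh d \<noteq> 0"
    using \<open>sin (c2 / 2) \<noteq> 0\<close> by (simp_all add: power_mult_distrib)
  moreover have "z - d = Complex (c1 * of_int n) (c2 * of_int m)"
    "z + d = Complex (c1 * of_int n) (c2 * of_int (m + 1))"
    by (simp_all add: z_def d_def complex_eq_iff algebra_simps)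
  moreover have "Re (sinh (2 * d)) = 0"
    by (simp add: d_def complex_hyperbolic)
  ultimately show "BP_edge (- 2 * (sin (c2 / 2))\<^sup>2) (BP_g c1 c2 (n, m)) (BP_g c1 c2 (n, m + 1)) =
      BP_map c1 c2 (n, m + 1) - BP_map c1 c2 (n, m)"
    using BP_edge_exp[of _ d z] by (simp add: g BP_map_def vec3_eq_iff complex_hyperbolic mult.commute)
qed

lemma BP_catenoid_iff:
  "BP_catenoid c1 c2 x \<longleftrightarrow> c1 > 0 \<and> (\<forall>j::int. c2 \<noteq> 2 * pi * of_int j) \<and> x = BP_map c1 c2"
proof
  assume "BP_catenoid c1 c2 x"
  then have c: "c1 > 0" "\<And>j::int. c2 \<noteq> 2 * pi * of_int j" and x0: "x (0, 0) = vector [1, 0, 0]"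
    and steps: "\<And>n m. x (n + 1, m) - x (n, m) = BP_map c1 c2 (n + 1, m) - BP_map c1 c2 (n, m)"
      "\<And>n m. x (n, m + 1) - x (n, m) = BP_map c1 c2 (n, m + 1) - BP_map c1 c2 (n, m)"
    using BP_edge_map by (auto simp: BP_catenoid_def)
  have "x (n, 0) = BP_map c1 c2 (n, 0)" for n
    by (rule int_seq_eq_if_equal_increments[of "\<lambda>n. x (n, 0)" "\<lambda>n. BP_map c1 c2 (n, 0)"])
      (auto simp: steps x0 BP_map_def)
  then have "x (n, m) = BP_map c1 c2 (n, m)" for n m
    by (rule int_seq_eq_if_equal_increments[of "\<lambda>m. x (n, m)" "\<lambda>m. BP_map c1 c2 (n, m)",
          OF steps(2)])
  with c show "c1 > 0 \<and> (\<forall>j::int. c2 \<noteq> 2 * pi * of_int j) \<and> x = BP_map c1 c2"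
    by (auto simp: fun_eq_iff)
next
  assume "c1 > 0 \<and> (\<forall>j::int. c2 \<noteq> 2 * pi * of_int j) \<and> x = BP_map c1 c2"
  then have c: "c1 > 0" "\<And>j::int. c2 \<noteq> 2 * pi * of_int j" and x: "x = BP_map c1 c2"
    by auto
  have "BP_map c1 c2 (0, 0) = vector [1, 0, 0]"
    by (simp add: BP_map_def)
  then show "BP_catenoid c1 c2 x"
    using BP_edge_map[OF c] c by (simp add: BP_catenoid_def x)
qed

lemma BP_map_profile: "BP_map c1 c2 (n, 0) = vector [cosh (of_int n * c1), 0, of_int n * sinh c1]"
  by (simp add: BP_map_def)

section \<open>Variational catenoids with smooth profile curve\<close>

text \<open>The area of one piece of a variational catenoid, with \<open>c = 2 (1 - cos \<theta>)\<close> and \<open>s = sin\<^sup>2 \<theta>\<close>.\<close>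

definition scaled_area :: "real \<Rightarrow> real \<Rightarrow> real \<Rightarrow> real \<Rightarrow> (real \<Rightarrow> real) \<Rightarrow> real" where
  "scaled_area c s a b x = integral {a..b} (\<lambda>t. x t * sqrt (c + s * (deriv x t)\<^sup>2))"

text \<open>Differentiation under the integral sign: the integrand is continuously differentiable in the
parameter because the radicand is bounded below by \<open>c > 0\<close>.\<close>

lemma first_variation:
  fixes x \<eta> :: "real \<Rightarrow> real"
  assumes "c > 0" "s \<ge> 0" and x: "smooth x" and \<eta>: "smooth \<eta>"
  shows "((\<lambda>\<epsilon>. scaled_area c s a b (\<lambda>t. x t + \<epsilon> * \<eta> t)) has_real_derivative
     integral {a..b} (\<lambda>t. \<eta> t * sqrt (c + s * (deriv x t)\<^sup>2) +
       deriv \<eta> t * (s * x t * deriv x t / sqrt (c + s * (deriv x t)\<^sup>2)))) (at 0)"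
proof -
  note x' = smooth_derivative(1)[OF x] and \<eta>' = smooth_derivative(1)[OF \<eta>]
  have deriv_var: "deriv (\<lambda>t. x t + \<epsilon> * \<eta> t) t = deriv x t + \<epsilon> * deriv \<eta> t" for \<epsilon> t
    by (rule DERIV_imp_deriv) (auto intro!: derivative_eq_intros x' \<eta>')
  define W where "W \<epsilon> t = sqrt (c + s * (deriv x t + \<epsilon> * deriv \<eta> t)\<^sup>2)" for \<epsilon> t
  have radicand: "c + s * v\<^sup>2 > 0" for v
    using assms(1,2) by (simp add: add_pos_nonneg)
  have W: "W \<epsilon> t > 0" for \<epsilon> t
    by (simp add: W_def radicand)
  have cont: "continuous_on A x" "continuous_on A \<eta>"
      "continuous_on A (deriv x)" "continuous_on A (deriv \<eta>)" for A
    using smooth_derivative[OF x] smooth_derivative[OF \<eta>] smooth_derivative(1)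
    by (meson DERIV_continuous_on DERIV_subset subset_UNIV)+
  have cont2: "continuous_on A (\<lambda>p. g (snd p))" if "\<And>B. continuous_on B g"
    for A :: "(real \<times> real) set" and g :: "real \<Rightarrow> real"
    by (rule continuous_on_compose2[OF that[of UNIV]]) (auto intro: continuous_intros)
  let ?D = "\<lambda>\<epsilon> t. \<eta> t * W \<epsilon> t +
      deriv \<eta> t * (s * (x t + \<epsilon> * \<eta> t) * (deriv x t + \<epsilon> * deriv \<eta> t) / W \<epsilon> t)"
  have "((\<lambda>\<epsilon>. integral (cbox a b) (\<lambda>t. (x t + \<epsilon> * \<eta> t) * W \<epsilon> t)) has_field_derivative
      integral (cbox a b) (?D 0)) (at 0 within UNIV)"
  proof (rule leibniz_rule_field_derivative)
    fix \<epsilon> t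
    have "((\<lambda>\<epsilon>. W \<epsilon> t) has_real_derivative
        s * (deriv x t + \<epsilon> * deriv \<eta> t) * deriv \<eta> t / W \<epsilon> t) (at \<epsilon>)"
      unfolding W_def using radicand[of "deriv x t + \<epsilon> * deriv \<eta> t"]
      by (auto intro!: derivative_eq_intros simp: field_simps)
    then show "((\<lambda>\<epsilon>. (x t + \<epsilon> * \<eta> t) * W \<epsilon> t) has_field_derivative ?D \<epsilon> t) (at \<epsilon> within UNIV)"
      by (auto intro!: derivative_eq_intros)
  next
    fix \<epsilon>
    show "(\<lambda>t. (x t + \<epsilon> * \<eta> t) * W \<epsilon> t) integrable_on cbox a b"
      unfolding W_def by (intro integrable_continuous continuous_intros cont)
  next
    have "W \<epsilon> t \<noteq> 0" for \<epsilon> t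
      using W[of \<epsilon> t] by simp
    then show "continuous_on (UNIV \<times> cbox a b) (\<lambda>(\<epsilon>, t). ?D \<epsilon> t)"
      unfolding W_def split_beta by (intro continuous_intros cont2 cont) auto
  qed auto
  then show ?thesis
    by (simp add: scaled_area_def deriv_var W_def)
qed

text \<open>A form of the fundamental lemma of the calculus of variations. The integrals vanish on every interval,
so a polynomial can serve as bump function: on a small interval around a point with
\<open>E t \<noteq> 0\<close>, \<open>(u - a) (b - u) E t\<close> is an admissible variation and its product with \<open>E\<close> is
nonnegative.\<close>

lemma eq_zero_if_variations_vanish:
  fixes E :: "real \<Rightarrow> real"
  assumes cont: "continuous_on UNIV E"
    and vanish: "\<And>a b \<eta>. a < b \<Longrightarrow> smooth \<eta> \<Longrightarrow> \<eta> a = 0 \<Longrightarrow> \<eta> b = 0 \<Longrightarrow>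
      integral {a..b} (\<lambda>t. \<eta> t * E t) = 0"
  shows "E t = 0"
proof (rule ccontr)
  assume "E t \<noteq> 0"
  have "continuous (at t) E"
    using cont by (simp add: continuous_on_eq_continuous_at)
  then have "\<forall>\<^sub>F u in at t. E u * E t > 0"
    using \<open>E t \<noteq> 0\<close> not_square_less_zero
    by (intro order_tendstoD(1)[of _ "E t * E t"])
      (auto intro!: tendsto_intros simp: continuous_within zero_less_mult_iff linorder_neq_iff)
  then obtain d where "d > 0" and d: "\<And>u. u \<noteq> t \<Longrightarrow> \<bar>u - t\<bar> < d \<Longrightarrow> E u * E t > 0"
    unfolding eventually_at dist_real_def by auto
  moreover have "E t * E t > 0"
    using \<open>E t \<noteq> 0\<close> not_real_square_gt_zero by blast
  ultimately have d: "d > 0" "\<And>u. \<bar>u - t\<bar> < d \<Longrightarrow> E u * E t > 0"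
    by metis+
  define a b where "a = t - d / 2" and "b = t + d / 2"
  \<comment> \<open>The factor \<open>E t\<close> gives the variation the sign of \<open>E\<close> near \<open>t\<close>.\<close>
  define \<eta> where "\<eta> = poly ([:- a, 1:] * [:b, - 1:] * [:E t:])"
  have "a < b"
    using d by (simp add: a_def b_def)
  have \<eta>: "\<eta> u * E u = (u - a) * (b - u) * (E u * E t)" for u
    by (simp add: \<eta>_def algebra_simps)
  have "integral {a..b} (\<lambda>u. \<eta> u * E u) = 0"
  proof (rule vanish[OF \<open>a < b\<close>])
    show "smooth \<eta>"
      unfolding \<eta>_def by (rule smooth_poly)
  qed (simp_all add: \<eta>_def algebra_simps)
  moreover have "\<eta> u * E u \<ge> 0" if "u \<in> {a..b}" for u
  proof -
    have "\<bar>u - t\<bar> < d"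
      using that d(1) by (auto simp: a_def b_def)
    then show ?thesis
      unfolding \<eta> using that d(2)[of u] by simp
  qed
  moreover have "continuous_on {a..b} (\<lambda>u. \<eta> u * E u)"
    unfolding \<eta>_def by (intro continuous_intros continuous_on_subset[OF cont]) auto
  ultimately have "\<eta> t * E t = 0"
    using integral_eq_0_iff[of a b "\<lambda>u. \<eta> u * E u"] \<open>a < b\<close> d(1)
    by (auto simp: a_def b_def)
  then show False
    unfolding \<eta> using d(1) \<open>E t \<noteq> 0\<close> by (simp add: a_def b_def)
qed

lemma integral_by_parts_vanishing:
  fixes \<eta> P :: "real \<Rightarrow> real"
  assumes "a < b" and \<eta>: "smooth \<eta>" "\<eta> a = 0" "\<eta> b = 0"
    and P: "\<And>t. (P has_real_derivative P' t) (at t)"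
  shows "((\<lambda>t. \<eta> t * P' t + deriv \<eta> t * P t) has_integral 0) {a..b}"
proof -
  have "((\<lambda>t. \<eta> t * P t) has_vector_derivative (\<eta> t * P' t + deriv \<eta> t * P t)) (at t within {a..b})" for t
    unfolding has_real_derivative_iff_has_vector_derivative[symmetric]
    by (rule DERIV_subset[of _ _ _ UNIV])
      (auto intro!: derivative_eq_intros P smooth_derivative \<eta>)
  then show ?thesis
    using fundamental_theorem_of_calculus[of a b "\<lambda>t. \<eta> t * P t"] \<open>a < b\<close> \<eta> by simp
qed

text \<open>With \<open>W = sqrt (c + s x'\<^sup>2)\<close> and the momentum \<open>P = s x x' / W\<close>, the first variation is the integral of
\<open>\<eta> W + \<eta>' P\<close>, so the Euler-Lagrange equation is \<open>W = P'\<close>. The difference \<open>W - P'\<close> simplifies to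
\<open>c (c + s x'\<^sup>2 - s x x'') / W\<^sup>3\<close>.\<close>

lemma stationary_imp_catenary_equation:
  fixes x :: "real \<Rightarrow> real"
  assumes "c > 0" "s > 0" and x: "smooth x"
    and stationary: "\<And>a b \<eta>. a < b \<Longrightarrow> smooth \<eta> \<Longrightarrow> \<eta> a = 0 \<Longrightarrow> \<eta> b = 0 \<Longrightarrow>
      ((\<lambda>\<epsilon>. scaled_area c s a b (\<lambda>t. x t + \<epsilon> * \<eta> t)) has_real_derivative 0) (at 0)"
  shows "s * (x t * deriv (deriv x) t) = c + s * (deriv x t)\<^sup>2"
proof -
  define x1 x2 where "x1 = deriv x" and "x2 = deriv (deriv x)"
  have sm: "smooth x" "smooth x1" "smooth x2"
    using smooth_derivative(2) x by (auto simp: x1_def x2_def)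
  have der: "(x has_real_derivative x1 t) (at t)" "(x1 has_real_derivative x2 t) (at t)" for t
    using smooth_derivative(1) sm by (auto simp: x1_def x2_def)
  have cont: "continuous_on A x" "continuous_on A x1" "continuous_on A x2" for A
    using sm smooth_derivative(1) by (meson DERIV_continuous_on DERIV_subset subset_UNIV)+
  define W where "W t = sqrt (c + s * (x1 t)\<^sup>2)" for t
  define P where "P t = s * x t * x1 t / W t" for t
  define E where "E t = c * (c + s * (x1 t)\<^sup>2 - s * (x t * x2 t)) / (W t)^3" for t
  have radicand: "c + s * v\<^sup>2 > 0" for v
    using assms(1,2) by (simp add: add_pos_nonneg)
  have W: "W t > 0" "W t \<noteq> 0" "(W t)\<^sup>2 = c + s * (x1 t)\<^sup>2" for t
    using radicand[of "x1 t"] by (simp_all add: W_def)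
  have P': "(P has_real_derivative W t - E t) (at t)" for t
  proof -
    have W': "(W has_real_derivative s * x1 t * x2 t / W t) (at t)"
      unfolding W_def using radicand[of "x1 t"]
      by (auto intro!: derivative_eq_intros der simp: field_simps)
    have "(P has_real_derivative
        ((s * x1 t * x1 t + s * x t * x2 t) * W t - s * x t * x1 t * (s * x1 t * x2 t / W t)) /
        (W t * W t)) (at t)"
      unfolding P_def using W(2) by (auto intro!: derivative_eq_intros der W' simp: algebra_simps)
    moreover have "((s * x1 t * x1 t + s * x t * x2 t) * W t - s * x t * x1 t * (s * x1 t * x2 t / W t)) /
        (W t * W t) = W t - E t"
    proof -
      have "(s * x1 t * x1 t + s * x t * x2 t) * (W t)\<^sup>2 - s * x t * x1 t * (s * x1 t * x2 t) =
          (W t)\<^sup>2 * (W t)\<^sup>2 - c * (c + s * (x1 t)\<^sup>2 - s * (x t * x2 t))"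
        unfolding W(3) by (simp add: power2_eq_square algebra_simps)
      then show ?thesis
        using W(2)[of t] by (simp add: E_def power2_eq_square power3_eq_cube field_simps)
    qed
    ultimately show ?thesis by simp
  qed
  have "E t = 0" for t
  proof (rule eq_zero_if_variations_vanish[of E])
    show "continuous_on UNIV E"
      unfolding E_def W_def using radicand
      by (intro continuous_intros cont) (auto simp: less_imp_neq[symmetric])
    fix a b :: real and \<eta> :: "real \<Rightarrow> real"
    assume ab: "a < b" and \<eta>: "smooth \<eta>" "\<eta> a = 0" "\<eta> b = 0"
    have 0: "integral {a..b} (\<lambda>t. \<eta> t * W t + deriv \<eta> t * P t) = 0"
      using DERIV_unique[OF first_variation[OF \<open>c > 0\<close> less_imp_le[OF \<open>s > 0\<close>] x \<eta>(1)]
          stationary[OF ab \<eta>]]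
      by (simp add: W_def P_def x1_def)
    have "continuous_on A \<eta>" "continuous_on A (deriv \<eta>)" for A
      using smooth_derivative[OF \<eta>(1)] smooth_derivative(1)
      by (meson DERIV_continuous_on DERIV_subset subset_UNIV)+
    then have "(\<lambda>t. \<eta> t * W t + deriv \<eta> t * P t) integrable_on {a..b}"
      using W(2) radicand unfolding P_def W_def
      by (intro integrable_continuous_real continuous_intros cont)
        (auto simp: less_imp_neq[symmetric])
    then have "((\<lambda>t. \<eta> t * W t + deriv \<eta> t * P t) has_integral 0) {a..b}"
      using 0 by (simp add: has_integral_integral)
    from has_integral_diff[OF this integral_by_parts_vanishing[OF ab \<eta> P']]
    show "integral {a..b} (\<lambda>t. \<eta> t * E t) = 0"
      by (intro integral_unique) (simp add: algebra_simps)
  qed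
  then have "c * (c + s * (x1 t)\<^sup>2 - s * (x t * x2 t)) / (W t)^3 = 0"
    by (simp add: E_def)
  then have "c * (c + s * (x1 t)\<^sup>2 - s * (x t * x2 t)) = 0"
    using W(2)[of t] by simp
  then show ?thesis
    using \<open>c > 0\<close> by (simp add: x1_def x2_def)
qed

text \<open>Here \<open>W\<close> and \<open>P\<close> are multiples of \<open>cosh (\<beta> t)\<close> and \<open>sinh (\<beta> t)\<close> with \<open>P' = W\<close>, so the first
variation is the integral of the derivative of \<open>\<eta> P\<close>.\<close>

lemma cosh_stationary:
  fixes \<beta> :: real
  assumes "s > 0" "\<beta> > 0" and c: "c = s * \<beta>\<^sup>2" and "a < b" and \<eta>: "smooth \<eta>" "\<eta> a = 0" "\<eta> b = 0"
  shows "((\<lambda>\<epsilon>. scaled_area c s a b (\<lambda>t. cosh (\<beta> * t) + \<epsilon> * \<eta> t)) has_real_derivative 0) (at 0)"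
proof -
  have "c > 0"
    using assms by simp
  have deriv_cosh: "deriv (\<lambda>t. cosh (\<beta> * t)) t = \<beta> * sinh (\<beta> * t)" for t
    by (rule DERIV_imp_deriv) (auto intro!: derivative_eq_intros)
  have W: "sqrt (c + s * (\<beta> * sinh (\<beta> * t))\<^sup>2) = sqrt c * cosh (\<beta> * t)" for t
  proof -
    have "c + s * (\<beta> * sinh (\<beta> * t))\<^sup>2 = c * (cosh (\<beta> * t))\<^sup>2"
      by (simp add: c cosh_square_eq power_mult_distrib algebra_simps)
    then show ?thesis
      by (simp add: real_sqrt_mult)
  qed
  define \<mu> where "\<mu> = s * \<beta> / sqrt c"
  let ?P = "\<lambda>t. \<mu> * sinh (\<beta> * t)"
  have P: "s * cosh (\<beta> * t) * (\<beta> * sinh (\<beta> * t)) / (sqrt c * cosh (\<beta> * t)) = ?P t" for t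
    by (simp add: \<mu>_def)
  have "\<mu> * \<beta> = c / sqrt c"
    by (simp add: \<mu>_def c power2_eq_square)
  also have "\<dots> = sqrt c"
    using \<open>c > 0\<close> by (simp add: real_div_sqrt)
  finally have "(?P has_real_derivative sqrt c * cosh (\<beta> * t)) (at t)" for t
    by (auto intro!: derivative_eq_intros simp: mult.commute)
  from integral_by_parts_vanishing[OF \<open>a < b\<close> \<eta> this]
  have "integral {a..b} (\<lambda>t. \<eta> t * (sqrt c * cosh (\<beta> * t)) + deriv \<eta> t * ?P t) = 0"
    by (rule integral_unique)
  moreover have "smooth (\<lambda>t. cosh (\<beta> * t))"
    by (rule smooth_cosh)
  ultimately show ?thesis
    using first_variation[OF \<open>c > 0\<close> less_imp_le[OF \<open>s > 0\<close>] _ \<eta>(1), of "\<lambda>t. cosh (\<beta> * t)" a b]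
    unfolding deriv_cosh W P by simp
qed

text \<open>The square root of \<open>c / s = 2 (1 - cos \<theta>) / sin\<^sup>2 \<theta>\<close>, by which the smooth catenary is compressed
along the axis.\<close>

definition rotation_factor :: "nat \<Rightarrow> real" where
  "rotation_factor K = sqrt (2 / (1 + cos (2 * pi / real K)))"

lemma symmetry_angle_bounds:
  assumes "K \<ge> 3"
  shows "0 < sin (2 * pi / real K)" "- 1 / 2 \<le> cos (2 * pi / real K)" "cos (2 * pi / real K) < 1"
proof -
  have "2 * pi / real K \<le> 2 * pi / 3"
    using assms by (intro divide_left_mono) auto
  then have angle: "0 < 2 * pi / real K" "2 * pi / real K \<le> 2 * pi / 3"
    using assms by auto
  then have "2 * pi / real K < pi"
    using pi_gt_zero by linarith
  with angle show "0 < sin (2 * pi / real K)"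
    by (intro sin_gt_zero)
  have "cos (2 * pi / 3) \<le> cos (2 * pi / real K)"
    using angle by (intro cos_monotone_0_pi_le) auto
  then show "- 1 / 2 \<le> cos (2 * pi / real K)"
    by (simp add: cos_120)
  have "cos (2 * pi / real K) < cos 0"
    using angle \<open>2 * pi / real K < pi\<close> by (intro cos_monotone_0_pi) auto
  then show "cos (2 * pi / real K) < 1"
    by simp
qed

text \<open>The upper bound is attained at \<open>K = 3\<close>, where \<open>cos \<theta> = - 1 / 2\<close>.\<close>

lemma rotation_factor_bounds:
  assumes "K \<ge> 3"
  shows "1 < rotation_factor K" "rotation_factor K \<le> 2"
proof -
  note b = symmetry_angle_bounds[OF assms]
  have "1 < 2 / (1 + cos (2 * pi / real K))" "2 / (1 + cos (2 * pi / real K)) \<le> 2\<^sup>2"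
    using b by (auto simp: field_simps)
  then show "1 < rotation_factor K" "rotation_factor K \<le> 2"
    unfolding rotation_factor_def using real_le_lsqrt[of 2 "2 / (1 + cos (2 * pi / real K))"] 
    by auto
qed

lemma cos_symmetry_angle_tendsto: "(\<lambda>K. cos (2 * pi / real K)) \<longlonglongrightarrow> 1"
proof -
  have "(\<lambda>K. cos (2 * pi / real K)) \<longlonglongrightarrow> cos 0"
    by (intro tendsto_cos tendsto_divide_0[OF tendsto_const] filterlim_real_at_infinity_sequentially)
  then show ?thesis by simp
qed

lemma rotation_factor_tendsto: "rotation_factor \<longlonglongrightarrow> 1"
proof -
  have "(\<lambda>K. sqrt (2 / (1 + cos (2 * pi / real K)))) \<longlonglongrightarrow> sqrt (2 / (1 + 1))"
    by (intro tendsto_intros cos_symmetry_angle_tendsto) auto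
  then show ?thesis
    by (simp add: rotation_factor_def[abs_def])
qed

text \<open>Since \<open>sin\<^sup>2 \<theta> = (1 - cos \<theta>) (1 + cos \<theta>)\<close>, the quotient of the two constants in the area is
\<open>2 / (1 + cos \<theta>)\<close>, the square of the rotation factor.\<close>

lemma M_ps_rd_catenoid_iff:
  "M_ps_rd_catenoid K x \<longleftrightarrow> K \<ge> 3 \<and> x = (\<lambda>t. cosh (rotation_factor K * t))"
proof (cases "K \<ge> 3")
  case True
  note bounds = symmetry_angle_bounds[OF True]
  define c s \<beta> where "c = 2 * (1 - cos (2 * pi / real K))" and "s = (sin (2 * pi / real K))\<^sup>2"
    and "\<beta> = rotation_factor K"
  have "c > 0" "s > 0" "\<beta> > 0"
    using bounds rotation_factor_bounds[OF True] by (auto simp: c_def s_def \<beta>_def)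
  have "s = (1 - cos (2 * pi / real K)) * (1 + cos (2 * pi / real K))"
    by (simp add: s_def sin_squared_eq power2_eq_square algebra_simps)
  then have c: "c = s * \<beta>\<^sup>2"
    using bounds by (simp add: c_def \<beta>_def rotation_factor_def field_simps)
  have critical: "M_ps_rd_critical K a b x \<longleftrightarrow> (\<forall>\<eta>. smooth \<eta> \<and> \<eta> a = 0 \<and> \<eta> b = 0 \<longrightarrow>
      ((\<lambda>\<epsilon>. scaled_area c s a b (\<lambda>t. x t + \<epsilon> * \<eta> t)) has_real_derivative 0) (at 0))" for a b x
    by (simp add: M_ps_rd_critical_def M_ps_rd_area_def scaled_area_def c_def s_def)
  show ?thesis
  proof
    assume "M_ps_rd_catenoid K x"
    then have x: "smooth x" "\<And>t. x t > 0" "x 0 = 1" "deriv x 0 = 0"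
      and crit: "\<And>a b. a < b \<Longrightarrow> M_ps_rd_critical K a b x"
      by (auto simp: M_ps_rd_catenoid_def)
    have "x t * deriv (deriv x) t = (deriv x t)\<^sup>2 + \<beta>\<^sup>2" for t
    proof -
      have "s * (x t * deriv (deriv x) t) = c + s * (deriv x t)\<^sup>2"
        using crit by (intro stationary_imp_catenary_equation \<open>c > 0\<close> \<open>s > 0\<close> x) (auto simp: critical)
      then have "s * (x t * deriv (deriv x) t) = s * ((deriv x t)\<^sup>2 + \<beta>\<^sup>2)"
        by (simp add: c algebra_simps)
      then show ?thesis
        using \<open>s > 0\<close> by simp
    qed
    then have "x t = cosh (\<beta> * t)" for t
      using x \<open>\<beta> > 0\<close>
      by (intro catenary_equation_solution[of x "deriv x" "deriv (deriv x)"] smooth_derivative) auto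
    then show "K \<ge> 3 \<and> x = (\<lambda>t. cosh (rotation_factor K * t))"
      using True by (auto simp: \<beta>_def)
  next
    assume "K \<ge> 3 \<and> x = (\<lambda>t. cosh (rotation_factor K * t))"
    then have x: "x = (\<lambda>t. cosh (\<beta> * t))"
      by (simp add: \<beta>_def)
    have "deriv (\<lambda>t. cosh (\<beta> * t)) 0 = 0"
      by (rule DERIV_imp_deriv) (auto intro!: derivative_eq_intros)
    moreover have "smooth (\<lambda>t. cosh (\<beta> * t))"
      by (rule smooth_cosh)
    ultimately show "M_ps_rd_catenoid K x"
      using True cosh_stationary[OF \<open>s > 0\<close> \<open>\<beta> > 0\<close> c]
      by (auto simp: M_ps_rd_catenoid_def critical x)
  qed
qed (simp add: M_ps_rd_catenoid_def)

section \<open>Comparison of the profile curves\<close>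

definition discrete_catenary :: "real \<Rightarrow> real \<Rightarrow> int \<Rightarrow> real^3" where
  "discrete_catenary l a n = vector [cosh (of_int n * a), 0, of_int n * l]"

text \<open>Each vertical step is a positive integer multiple of the other, so they are equal; then the vertices
at height \<open>l\<close> determine the hyperbolic step.\<close>

lemma range_discrete_catenary_eq_iff:
  assumes "l > 0" "l' > 0" "a > 0" "a' > 0"
  shows "range (discrete_catenary l a) = range (discrete_catenary l' a') \<longleftrightarrow> l = l' \<and> a = a'"
proof
  assume eq: "range (discrete_catenary l a) = range (discrete_catenary l' a')"
  have "discrete_catenary l a 1 \<in> range (discrete_catenary l' a')"
    using eq by blast
  then obtain n where n: "discrete_catenary l a 1 = discrete_catenary l' a' n"
    by blast
  have "discrete_catenary l' a' 1 \<in> range (discrete_catenary l a)"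
    using eq by blast
  then obtain m where m: "discrete_catenary l' a' 1 = discrete_catenary l a m"
    by blast
  have l: "l = of_int n * l'" "l' = of_int m * l"
    using n m by (auto simp: discrete_catenary_def vec3_eq_iff)
  then have "of_int n > (0 :: real)"
    using assms by (metis zero_less_mult_pos2)
  then have "n > 0"
    by simp
  have "of_int (n * m) * l = l"
    using l by (simp add: mult.assoc)
  then have "of_int (n * m) = (1 :: real)"
    using \<open>l > 0\<close> by simp
  then have "n = 1"
    using \<open>n > 0\<close> by (metis of_int_eq_1_iff pos_zmult_eq_1_iff)
  then have "cosh a = cosh a'"
    using n by (simp add: discrete_catenary_def vec3_eq_iff)
  then show "l = l' \<and> a = a'"
    using assms l(1) \<open>n = 1\<close> by simp
qed simp

lemma on_scaled_cosh_discrete_catenary: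
  assumes "l > 0" "a > 0"
  shows "on_scaled_cosh (range (discrete_catenary l a))"
  unfolding on_scaled_cosh_def
  by (rule exI[of _ 1], rule exI[of _ "a / l"]) (use assms in \<open>auto simp: discrete_catenary_def mult.commute\<close>)

lemma on_scaled_cosh_graph: "b > 0 \<Longrightarrow> on_scaled_cosh (graph_profile (\<lambda>t. cosh (b * t)))"
  unfolding on_scaled_cosh_def graph_profile_def
  by (rule exI[of _ 1], rule exI[of _ b]) auto

lemma graph_profile_eq_iff: "graph_profile f = graph_profile g \<longleftrightarrow> f = g"
proof
  assume eq: "graph_profile f = graph_profile g"
  show "f = g"
  proof
    fix t
    have "vector [f t, 0, t] \<in> graph_profile g"
      unfolding eq[symmetric] by (simp add: graph_profile_def)
    then show "f t = g t"
      by (auto simp: graph_profile_def vec3_eq_iff)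
  qed
qed simp

text \<open>The recursion of the Chebyshev polynomials is the identity
\<open>cosh (u + a) + cosh (u - a) = 2 cosh u cosh a\<close>.\<close>

lemma chebyshev_T_cosh: "chebyshev_T n (cosh a) = cosh (of_nat n * a)"
proof (induction n "cosh a" rule: chebyshev_T.induct)
  case (3 n)
  have "2 * cosh u * cosh a = cosh (u + a) + cosh (u - a)" for u
    by (simp add: cosh_add cosh_diff)
  from this[of "of_nat (Suc n) * a"] show ?case
    using 3 by (simp add: algebra_simps)
qed simp_all

lemma M_pd_rs_vertex_eq: "M_pd_rs_vertex L = discrete_catenary L (arcosh (1 + L\<^sup>2 / 2))"
proof
  fix n
  have T: "chebyshev_T k (1 + L\<^sup>2 / 2) = cosh (of_nat k * arcosh (1 + L\<^sup>2 / 2))" for k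
    using chebyshev_T_cosh[of k "arcosh (1 + L\<^sup>2 / 2)"] by simp
  have even: "cosh (\<bar>of_int n\<bar> * a) = cosh (of_int n * a)" for a :: real
    by (cases "n \<ge> 0") auto
  show "M_pd_rs_vertex L n = discrete_catenary L (arcosh (1 + L\<^sup>2 / 2)) n"
    by (simp add: M_pd_rs_vertex_def discrete_catenary_def T even)
qed

definition PR_step :: "real \<Rightarrow> nat \<Rightarrow> real" where
  "PR_step l K = arcosh (1 + l\<^sup>2 / (1 + cos (2 * pi / real K)))"

lemma PR_vertex_eq: "PR_vertex l K = discrete_catenary l (PR_step l K)"
  by (simp add: PR_vertex_def discrete_catenary_def PR_step_def fun_eq_iff)

text \<open>This separates the integrable-systems types from the variational ones: \<open>cosh (arsinh l) = sqrt (1 + l\<^sup>2)\<close>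
is less than \<open>1 + l\<^sup>2 / 2\<close>, the tangent line of \<open>sqrt (1 + y)\<close> at \<open>0\<close>, taken at \<open>y = l\<^sup>2\<close>.\<close>

lemma arsinh_less_arcosh_step:
  fixes l :: real
  assumes "l > 0"
  shows "arsinh l < arcosh (1 + l\<^sup>2 / 2)"
proof -
  have "sqrt (l\<^sup>2 + 1) < 1 + l\<^sup>2 / 2"
  proof (rule real_less_lsqrt)
    have "(l\<^sup>2)\<^sup>2 > 0"
      using assms by simp
    then show "l\<^sup>2 + 1 < (1 + l\<^sup>2 / 2)\<^sup>2"
      by (simp add: power2_sum power_divide)
  qed (auto intro!: add_nonneg_nonneg)
  then have "cosh (arsinh l) < cosh (arcosh (1 + l\<^sup>2 / 2))"
    by (simp add: cosh_arsinh_real)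
  then show ?thesis
    using assms by (subst (asm) cosh_real_nonneg_less_iff) (auto intro: less_imp_le)
qed

text \<open>This separates the two variational types: discretizing also the rotation increases the step, because
\<open>1 + cos \<theta> < 2\<close>.\<close>

lemma arcosh_less_PR_step:
  assumes "l > 0" "K \<ge> 3"
  shows "arcosh (1 + l\<^sup>2 / 2) < PR_step l K"
proof -
  have less: "1 + l\<^sup>2 / 2 < 1 + l\<^sup>2 / (1 + cos (2 * pi / real K))"
    using assms(1) symmetry_angle_bounds[OF assms(2)]
    by (intro add_strict_left_mono divide_strict_left_mono) auto
  have ge: "1 \<le> 1 + l\<^sup>2 / 2"
    by simp
  show ?thesis
    unfolding PR_step_def
    by (rule arcosh_less_iff_real[THEN iffD2, OF ge order_trans[OF ge less_imp_le[OF less]] less])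
qed

lemma arcosh_step_pos: "l > 0 \<Longrightarrow> arcosh (1 + l\<^sup>2 / 2) > 0" for l :: real
  by (intro arcosh_real_gt_1_iff[THEN iffD2]) auto

lemma PR_step_pos: "l > 0 \<Longrightarrow> K \<ge> 3 \<Longrightarrow> PR_step l K > 0"
  using arcosh_step_pos arcosh_less_PR_step by (rule less_trans)

lemma PR_step_tendsto: "PR_step l \<longlonglongrightarrow> arcosh (1 + l\<^sup>2 / 2)" if "l > 0"
proof -
  have "(\<lambda>K. arcosh (1 + l\<^sup>2 / (1 + cos (2 * pi / real K)))) \<longlonglongrightarrow> arcosh (1 + l\<^sup>2 / (1 + 1))"
    using that by (intro tendsto_arcosh tendsto_intros cos_symmetry_angle_tendsto) auto
  then show ?thesis
    by (simp add: PR_step_def[abs_def])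
qed

lemma discrete_catenary_tendsto:
  assumes "(a \<longlongrightarrow> a0) F"
  shows "((\<lambda>k. discrete_catenary l (a k) n) \<longlongrightarrow> discrete_catenary l a0 n) F"
proof (rule vec_tendstoI)
  fix i :: 3
  have "((\<lambda>k. cosh (of_int n * a k)) \<longlongrightarrow> cosh (of_int n * a0)) F"
    by (intro tendsto_intros assms)
  then show "((\<lambda>k. discrete_catenary l (a k) n $ i) \<longlongrightarrow> discrete_catenary l a0 n $ i) F"
    using exhaust_3[of i] by (auto simp: discrete_catenary_def)
qed

lemma PR_vertex_tendsto: "(\<lambda>K. PR_vertex l K n) \<longlonglongrightarrow> M_pd_rs_vertex l n" if "l > 0"
  unfolding PR_vertex_eq M_pd_rs_vertex_eq
  by (intro discrete_catenary_tendsto PR_step_tendsto that)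

lemma MW_pd_rs_profile_eq:
  assumes "MW_pd_rs_catenoid h f"
  shows "h > 0" "MW_pd_rs_profile h f = range (discrete_catenary h (arsinh h))"
  using assms unfolding MW_pd_rs_catenoid_iff
  by (auto simp: MW_pd_rs_profile_def discrete_catenary_def mult.commute)

lemma BP_profile_eq:
  assumes "BP_catenoid c1 c2 x"
  shows "c1 > 0" "BP_profile x = range (discrete_catenary (sinh c1) (arsinh (sinh c1)))"
  using assms unfolding BP_catenoid_iff
  by (auto simp: BP_profile_def BP_map_profile discrete_catenary_def arsinh_sinh_real)

text \<open>Both families of profile curves consist of the discrete catenaries with hyperbolic step \<open>arsinh l\<close>.\<close>

lemma BP_and_MW_profiles:
  "{BP_profile x | x c1 c2. BP_catenoid c1 c2 x} = {MW_pd_rs_profile h f | h f. MW_pd_rs_catenoid h f}"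
proof (intro subset_antisym subsetI)
  fix P assume "P \<in> {BP_profile x | x c1 c2. BP_catenoid c1 c2 x}"
  then obtain x c1 c2 where "P = BP_profile x" and x: "BP_catenoid c1 c2 x"
    by blast
  moreover have "MW_pd_rs_catenoid (sinh c1) (\<lambda>k. cosh (of_int k * arsinh (sinh c1)))"
    using BP_profile_eq(1)[OF x] by (simp add: MW_pd_rs_catenoid_iff)
  ultimately show "P \<in> {MW_pd_rs_profile h f | h f. MW_pd_rs_catenoid h f}"
    using BP_profile_eq(2)[OF x] MW_pd_rs_profile_eq(2) by blast
next
  fix P assume "P \<in> {MW_pd_rs_profile h f | h f. MW_pd_rs_catenoid h f}"
  then obtain h f where "P = MW_pd_rs_profile h f" and f: "MW_pd_rs_catenoid h f"
    by blast
  \<comment> \<open>Any admissible angle of rotation serves; \<open>pi\<close> is one.\<close>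
  have "cos pi \<noteq> 1"
    by simp
  then have "BP_catenoid (arsinh h) pi (BP_map (arsinh h) pi)"
    using MW_pd_rs_profile_eq(1)[OF f] unfolding BP_catenoid_iff cos_neq_1_iff by simp
  then have "BP_profile (BP_map (arsinh h) pi) = P"
    using BP_profile_eq(2) MW_pd_rs_profile_eq(2)[OF f] \<open>P = _\<close> by fastforce
  with \<open>BP_catenoid _ _ _\<close> show "P \<in> {BP_profile x | x c1 c2. BP_catenoid c1 c2 x}"
    by blast
qed

lemma dist_vec3_first: "dist (vector [x, b, c] :: real^3) (vector [y, b, c]) = \<bar>x - y\<bar>"
  by (simp add: dist_norm norm_eq_sqrt_inner inner_vec3 flip: power2_eq_square)

text \<open>The difference \<open>cosh (\<beta> t) - cosh t\<close> is \<open>2 sinh ((\<beta> + 1) t / 2) sinh ((\<beta> - 1) t / 2)\<close>, where the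
second factor is uniformly small.\<close>

lemma uniform_limit_cosh_scaled:
  fixes \<beta> :: "nat \<Rightarrow> real"
  assumes lim: "\<beta> \<longlonglongrightarrow> 1"
  shows "uniform_limit {a..b} (\<lambda>n t. cosh (\<beta> n * t)) cosh sequentially"
proof (rule uniform_limitI)
  fix e :: real assume "e > 0"
  define M where "M = max \<bar>a\<bar> \<bar>b\<bar>"
  define bound where "bound n = 2 * sinh (\<bar>\<beta> n + 1\<bar> / 2 * M) * sinh (\<bar>\<beta> n - 1\<bar> / 2 * M)" for n
  have "bound \<longlonglongrightarrow> 2 * sinh (\<bar>1 + 1\<bar> / 2 * M) * sinh (\<bar>1 - 1\<bar> / 2 * M)"
    unfolding bound_def by (intro tendsto_intros lim) auto
  then have "bound \<longlonglongrightarrow> 0"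
    by simp
  then have "\<forall>\<^sub>F n in sequentially. bound n < e"
    using \<open>e > 0\<close> by (rule order_tendstoD)
  then show "\<forall>\<^sub>F n in sequentially. \<forall>t\<in>{a..b}. dist (cosh (\<beta> n * t)) (cosh t) < e"
  proof eventually_elim
    case (elim n)
    show ?case
    proof
      fix t assume "t \<in> {a..b}"
      then have "\<bar>t\<bar> \<le> M"
        by (auto simp: M_def)
      define u v where "u = (\<beta> n + 1) / 2 * t" and "v = (\<beta> n - 1) / 2 * t"
      have uv: "u + v = \<beta> n * t" "u - v = t"
        by (simp_all add: u_def v_def field_simps)
      have "cosh (u + v) - cosh (u - v) = 2 * sinh u * sinh v"
        by (simp add: cosh_add cosh_diff)
      then have "dist (cosh (\<beta> n * t)) (cosh t) = 2 * sinh \<bar>u\<bar> * sinh \<bar>v\<bar>"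
        unfolding uv by (simp add: dist_real_def abs_mult)
      also have "\<dots> \<le> bound n"
        unfolding bound_def u_def v_def using \<open>\<bar>t\<bar> \<le> M\<close>
        by (intro mult_mono) (auto simp: abs_mult intro!: mult_left_mono)
      also have "\<dots> < e"
        by (rule elim)
      finally show "dist (cosh (\<beta> n * t)) (cosh t) < e" .
    qed
  qed
qed

lemma M_ps_rd_profiles_converge:
  assumes "\<And>K. K \<ge> 3 \<Longrightarrow> M_ps_rd_catenoid K (X K)"
  shows "uniform_limit {a..b} (\<lambda>K t. vector [X K t, 0, t] :: real^3) (\<lambda>t. vector [cosh t, 0, t])
    sequentially"
proof (rule uniform_limitI)
  fix e :: real assume "e > 0"
  with uniform_limit_cosh_scaled[OF rotation_factor_tendsto]
  have "\<forall>\<^sub>F K in sequentially. \<forall>t\<in>{a..b}. dist (cosh (rotation_factor K * t)) (cosh t) < e"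
    by (rule uniform_limitD)
  with eventually_ge_at_top[of 3]
  show "\<forall>\<^sub>F K in sequentially. \<forall>t\<in>{a..b}.
      dist (vector [X K t, 0, t] :: real^3) (vector [cosh t, 0, t]) < e"
  proof eventually_elim
    case (elim K)
    moreover have "X K = (\<lambda>t. cosh (rotation_factor K * t))"
      using assms[OF elim(1)] by (simp add: M_ps_rd_catenoid_iff)
    ultimately show ?case
      by (simp add: dist_vec3_first dist_real_def)
  qed
qed

lemma PR_neq_M_pd_rs:
  assumes "l > 0" "K \<ge> 3" "L > 0"
  shows "range (PR_vertex l K) \<noteq> range (M_pd_rs_vertex L)"
  unfolding PR_vertex_eq M_pd_rs_vertex_eq
  using assms range_discrete_catenary_eq_iff[of l L "PR_step l K" "arcosh (1 + L\<^sup>2 / 2)"]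
    arcosh_less_PR_step[of l K] PR_step_pos[of l K] arcosh_step_pos[of L]
  by auto

lemma isothermic_neq_PR:
  assumes "h > 0" "l > 0" "K \<ge> 3"
  shows "range (discrete_catenary h (arsinh h)) \<noteq> range (PR_vertex l K)"
  unfolding PR_vertex_eq
  using assms range_discrete_catenary_eq_iff[of h l "arsinh h" "PR_step l K"]
    arcosh_less_PR_step[of l K] PR_step_pos[of l K] arsinh_less_arcosh_step[of h]
  by auto

lemma isothermic_neq_M_pd_rs:
  assumes "h > 0" "L > 0"
  shows "range (discrete_catenary h (arsinh h)) \<noteq> range (M_pd_rs_vertex L)"
  unfolding M_pd_rs_vertex_eq
  using assms range_discrete_catenary_eq_iff[of h L "arsinh h" "arcosh (1 + L\<^sup>2 / 2)"]
    arcosh_step_pos[of L] arsinh_less_arcosh_step[of h]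
  by auto

theorem theorem1:
  shows
    \<comment> \<open>1\<close>
    "((\<forall>l K L. l > 0 \<and> K \<ge> 3 \<and> L > 0 \<longrightarrow> range (PR_vertex l K) \<noteq> range (M_pd_rs_vertex L)) \<and>
      (\<forall>l n. l > 0 \<longrightarrow> (\<lambda>K. PR_vertex l K n) \<longlonglongrightarrow> M_pd_rs_vertex l n)) \<and>
     \<comment> \<open>2\<close>
     ({BP_profile x | x c1 c2. BP_catenoid c1 c2 x} =
        {MW_pd_rs_profile h f | h f. MW_pd_rs_catenoid h f} \<and>
      (\<forall>l > 0. (\<exists>!f. MW_pd_rs_catenoid l f) \<and>
         (\<forall>c1 c2. c1 > 0 \<and> (\<forall>j::int. c2 \<noteq> 2 * pi * of_int j) \<and> sinh c1 = l \<longrightarrow>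
            (\<exists>!x. BP_catenoid c1 c2 x) \<and>
            (\<forall>x f. BP_catenoid c1 c2 x \<and> MW_pd_rs_catenoid l f \<longrightarrow>
               BP_profile x = MW_pd_rs_profile l f)))) \<and>
     \<comment> \<open>3\<close>
     ((\<forall>c1 c2 x l K. BP_catenoid c1 c2 x \<and> l > 0 \<and> K \<ge> 3 \<longrightarrow>
         BP_profile x \<noteq> range (PR_vertex l K)) \<and>
      (\<forall>h f l K. MW_pd_rs_catenoid h f \<and> l > 0 \<and> K \<ge> 3 \<longrightarrow>
         MW_pd_rs_profile h f \<noteq> range (PR_vertex l K)) \<and>
      (\<forall>c1 c2 x L. BP_catenoid c1 c2 x \<and> L > 0 \<longrightarrow>
         BP_profile x \<noteq> range (M_pd_rs_vertex L)) \<and>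
      (\<forall>h f L. MW_pd_rs_catenoid h f \<and> L > 0 \<longrightarrow>
         MW_pd_rs_profile h f \<noteq> range (M_pd_rs_vertex L))) \<and>
     \<comment> \<open>4\<close>
     (\<forall>\<alpha>. \<alpha> > 0 \<and> (\<forall>j::int. \<alpha> \<noteq> 2 * pi * of_int j) \<longrightarrow>
        (\<exists>f. MW_ps_rd_catenoid \<alpha> f) \<and>
        (\<forall>f. MW_ps_rd_catenoid \<alpha> f \<longrightarrow> graph_profile f = smooth_catenoid_profile)) \<and>
     \<comment> \<open>5\<close>
     ((\<forall>K\<ge>3. \<exists>x. M_ps_rd_catenoid K x) \<and>
      (\<forall>K x. M_ps_rd_catenoid K x \<longrightarrow> graph_profile x \<noteq> smooth_catenoid_profile) \<and>
      (\<forall>X. (\<forall>K\<ge>3. M_ps_rd_catenoid K (X K)) \<longrightarrow>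
         (\<forall>a b. uniform_limit {a..b} (\<lambda>K t. vector [X K t, 0, t] :: real^3)
                   (\<lambda>t. vector [cosh t, 0, t]) sequentially))) \<and>
     \<comment> \<open>6\<close>
     (on_scaled_cosh smooth_catenoid_profile \<and>
      (\<forall>l K. l > 0 \<and> K \<ge> 3 \<longrightarrow> on_scaled_cosh (range (PR_vertex l K))) \<and>
      (\<forall>L > 0. on_scaled_cosh (range (M_pd_rs_vertex L))) \<and>
      (\<forall>c1 c2 x. BP_catenoid c1 c2 x \<longrightarrow> on_scaled_cosh (BP_profile x)) \<and>
      (\<forall>h f. MW_pd_rs_catenoid h f \<longrightarrow> on_scaled_cosh (MW_pd_rs_profile h f)) \<and>
      (\<forall>\<alpha> f. MW_ps_rd_catenoid \<alpha> f \<longrightarrow> on_scaled_cosh (graph_profile f)) \<and>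
      (\<forall>K x. M_ps_rd_catenoid K x \<longrightarrow> on_scaled_cosh (graph_profile x)))"
proof -
  have part1: "\<forall>l K L. l > 0 \<and> K \<ge> 3 \<and> L > 0 \<longrightarrow> range (PR_vertex l K) \<noteq> range (M_pd_rs_vertex L)"
      "\<forall>l n. l > 0 \<longrightarrow> (\<lambda>K. PR_vertex l K n) \<longlonglongrightarrow> M_pd_rs_vertex l n"
    by (simp_all add: PR_neq_M_pd_rs PR_vertex_tendsto)
  have part2: "\<forall>l>0. (\<exists>!f. MW_pd_rs_catenoid l f) \<and>
      (\<forall>c1 c2. c1 > 0 \<and> (\<forall>j::int. c2 \<noteq> 2 * pi * of_int j) \<and> sinh c1 = l \<longrightarrow>
        (\<exists>!x. BP_catenoid c1 c2 x) \<and>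
        (\<forall>x f. BP_catenoid c1 c2 x \<and> MW_pd_rs_catenoid l f \<longrightarrow>
           BP_profile x = MW_pd_rs_profile l f))"
  proof (intro allI impI conjI)
    show "\<exists>!f. MW_pd_rs_catenoid l f" if "l > 0" for l
      using that by (simp add: MW_pd_rs_catenoid_iff)
    show "\<exists>!x. BP_catenoid c1 c2 x"
      if "c1 > 0 \<and> (\<forall>j::int. c2 \<noteq> 2 * pi * of_int j) \<and> sinh c1 = l" for c1 c2 l
      using that by (simp add: BP_catenoid_iff)
    show "BP_profile x = MW_pd_rs_profile l f"
      if "c1 > 0 \<and> (\<forall>j::int. c2 \<noteq> 2 * pi * of_int j) \<and> sinh c1 = l"
        and "BP_catenoid c1 c2 x \<and> MW_pd_rs_catenoid l f" for c1 c2 l x f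
      using that BP_profile_eq(2)[of c1 c2 x] MW_pd_rs_profile_eq(2)[of l f] by simp
  qed
  have part3_BP: "\<forall>c1 c2 x l K. BP_catenoid c1 c2 x \<and> l > 0 \<and> K \<ge> 3 \<longrightarrow>
        BP_profile x \<noteq> range (PR_vertex l K)"
      "\<forall>c1 c2 x L. BP_catenoid c1 c2 x \<and> L > 0 \<longrightarrow> BP_profile x \<noteq> range (M_pd_rs_vertex L)"
    using isothermic_neq_PR isothermic_neq_M_pd_rs BP_profile_eq
    by (metis sinh_real_pos_iff)+
  have part3_MW: "\<forall>h f l K. MW_pd_rs_catenoid h f \<and> l > 0 \<and> K \<ge> 3 \<longrightarrow>
        MW_pd_rs_profile h f \<noteq> range (PR_vertex l K)"
      "\<forall>h f L. MW_pd_rs_catenoid h f \<and> L > 0 \<longrightarrow> MW_pd_rs_profile h f \<noteq> range (M_pd_rs_vertex L)"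
    using isothermic_neq_PR isothermic_neq_M_pd_rs MW_pd_rs_profile_eq by metis+
  have part4: "\<forall>\<alpha>. \<alpha> > 0 \<and> (\<forall>j::int. \<alpha> \<noteq> 2 * pi * of_int j) \<longrightarrow>
      (\<exists>f. MW_ps_rd_catenoid \<alpha> f) \<and>
      (\<forall>f. MW_ps_rd_catenoid \<alpha> f \<longrightarrow> graph_profile f = smooth_catenoid_profile)"
    by (auto simp: MW_ps_rd_catenoid_iff)
  have "\<forall>K\<ge>3. \<exists>x. M_ps_rd_catenoid K x"
    by (simp add: M_ps_rd_catenoid_iff)
  moreover have "\<forall>K x. M_ps_rd_catenoid K x \<longrightarrow> graph_profile x \<noteq> smooth_catenoid_profile"
  proof (intro allI impI notI)
    fix K x assume "M_ps_rd_catenoid K x" "graph_profile x = smooth_catenoid_profile"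
    then have "K \<ge> 3" and "(\<lambda>t. cosh (rotation_factor K * t)) = cosh"
      by (auto simp: M_ps_rd_catenoid_iff graph_profile_eq_iff)
    then have "cosh (rotation_factor K * 1) = cosh 1"
      by metis
    then show False
      using rotation_factor_bounds(1)[OF \<open>K \<ge> 3\<close>] by simp
  qed
  moreover have "\<forall>X. (\<forall>K\<ge>3. M_ps_rd_catenoid K (X K)) \<longrightarrow>
      (\<forall>a b. uniform_limit {a..b} (\<lambda>K t. vector [X K t, 0, t] :: real^3)
         (\<lambda>t. vector [cosh t, 0, t]) sequentially)"
    using M_ps_rd_profiles_converge by blast
  moreover have "on_scaled_cosh smooth_catenoid_profile"
    using on_scaled_cosh_graph[of 1] by simp
  moreover have "\<forall>l K. l > 0 \<and> K \<ge> 3 \<longrightarrow> on_scaled_cosh (range (PR_vertex l K))"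
    unfolding PR_vertex_eq
    using on_scaled_cosh_discrete_catenary PR_step_pos by blast
  moreover have "\<forall>L > 0. on_scaled_cosh (range (M_pd_rs_vertex L))"
    unfolding M_pd_rs_vertex_eq using on_scaled_cosh_discrete_catenary arcosh_step_pos by blast
  moreover have "\<forall>c1 c2 x. BP_catenoid c1 c2 x \<longrightarrow> on_scaled_cosh (BP_profile x)"
    using BP_profile_eq on_scaled_cosh_discrete_catenary
    by (metis arsinh_real_pos_iff sinh_real_pos_iff)
  moreover have "\<forall>h f. MW_pd_rs_catenoid h f \<longrightarrow> on_scaled_cosh (MW_pd_rs_profile h f)"
    using MW_pd_rs_profile_eq on_scaled_cosh_discrete_catenary by (metis arsinh_real_pos_iff)
  moreover have "\<forall>\<alpha> f. MW_ps_rd_catenoid \<alpha> f \<longrightarrow> on_scaled_cosh (graph_profile f)"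
    using on_scaled_cosh_graph[of 1] by (simp add: MW_ps_rd_catenoid_iff)
  moreover have "\<forall>K x. M_ps_rd_catenoid K x \<longrightarrow> on_scaled_cosh (graph_profile x)"
  proof (intro allI impI)
    fix K x assume "M_ps_rd_catenoid K x"
    then have "K \<ge> 3" "x = (\<lambda>t. cosh (rotation_factor K * t))"
      by (auto simp: M_ps_rd_catenoid_iff)
    then show "on_scaled_cosh (graph_profile x)"
      using on_scaled_cosh_graph[of "rotation_factor K"] rotation_factor_bounds(1)[of K] by simp
  qed
  ultimately show ?thesis
    using part1 part2 part3_BP part3_MW part4 BP_and_MW_profiles by (intro conjI)
qed

end
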